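(* Let $m\in\mathbb N$, $\lambda\in\mathbb T$ and $\alpha=\frac12$. There exists a function $f\in\mathcal H_{\lambda,m}$ such that $D_{\lambda,m}\big(\sigma_n^{\alpha}[f]-f\big)\nrightarrow0$ as $n\to\infty$.
   Context: $\mathbb N$ is the set of positive integers, $\mathbb D$ the open unit disc and $\mathbb T$ the unit circle in $\mathbb C$; $\mathcal O(\mathbb D)$ is the space of holomorphic functions on $\mathbb D$. For $\lambda\in\mathbb T$, $m\in\mathbb N$ and $f\in\mathcal O(\mathbb D)$, let $$D_{\lambda,m}(f)=\frac{1}{m!(m-1)!}\int_{\mathbb D}|f^{(m)}(z)|^2\,\frac{1-|z|^2}{|z-\lambda|^2}\,(1-|z|^2)^{m-1}\,dA(z),$$ where $dA$ is Lebesgue area measure on $\mathbb D$ normalized so that $\mathbb D$ has measure $1$ and $f^{(m)}$ is the $m$-th derivative (this is the weighted Dirichlet-type integral of order $m$ for the Dirac measure $\delta_\lambda$). The local Dirichlet space of order $m$ at $\lambda$ is $\mathcal H_{\lambda,m}=\{f\in\mathcal O(\mathbb D):D_{\lambda,m}(f)<\infty\}$. For $f(z)=\sum_{k\ge0}a_kz^k\in\mathcal O(\mathbb D)$, $\alpha\geqslant0$ and an integer $n\geqslant 0$, the generalized $n$-th Cesàro mean is $$\sigma_n^\alpha[f](z)=\binom{n+\alpha}{\alpha}^{-1}\sum_{k=0}^n\binom{n-k+\alpha}{\alpha}a_kz^k,\qquad \binom{j+\alpha}{\alpha}:=\frac{\Gamma(j+\alpha+1)}{\Gamma(\alpha+1)\Gamma(j+1)}.$$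 *)

theory Defs
  imports "HOL-Complex_Analysis.Complex_Analysis"
begin

text \<open>Elements of \<open>\<O>(\<D>)\<close> are total functions that are holomorphic on \<open>ball 0 1\<close>;
  their values outside the disc are irrelevant in every definition below.\<close>

text \<open>The integrand is nonnegative on the disc, so \<open>D\<^bsub>\<zeta>,m\<^esub>(f)\<close> is defined for every holomorphic \<open>f\<close>
  as an extended nonnegative real, with value \<open>\<infinity>\<close> exactly when the integral diverges.
  It is meant for \<open>m \<ge> 1\<close> and \<open>norm \<zeta> = 1\<close>.\<close>

definition dirichlet_integral :: "complex \<Rightarrow> nat \<Rightarrow> (complex \<Rightarrow> complex) \<Rightarrow> ennreal" where
  "dirichlet_integral \<zeta> m f =
     ennreal (1 / (fact m * fact (m - 1))) *
     (\<integral>\<^sup>+ z. ennreal ((norm ((deriv ^^ m) f z))\<^sup>2 * ((1 - (norm z)\<^sup>2) / (norm (z - \<zeta>))\<^sup>2)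
                     * (1 - (norm z)\<^sup>2) ^ (m - 1))
        \<partial>uniform_measure lborel (ball 0 1))"

definition local_dirichlet_space :: "complex \<Rightarrow> nat \<Rightarrow> (complex \<Rightarrow> complex) set" where
  "local_dirichlet_space \<zeta> m =
     {f. f holomorphic_on ball 0 1 \<and> dirichlet_integral \<zeta> m f < \<infinity>}"

definition cesaro_coeff :: "real \<Rightarrow> nat \<Rightarrow> real" where
  "cesaro_coeff \<alpha> j = Gamma (real j + \<alpha> + 1) / (Gamma (\<alpha> + 1) * Gamma (real j + 1))"

definition cesaro_mean :: "real \<Rightarrow> nat \<Rightarrow> (complex \<Rightarrow> complex) \<Rightarrow> complex \<Rightarrow> complex" where
  "cesaro_mean \<alpha> n f z =
     of_real (inverse (cesaro_coeff \<alpha> n)) *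
     (\<Sum>k = 0..n. of_real (cesaro_coeff \<alpha> (n - k)) * fps_nth (fps_expansion f 0) k * z ^ k)"

end

theory Submission
  imports Defs "HOL-Probability.Distributions"
begin

text \<open>
  If \<open>f\<close> has coefficients \<open>cnj \<zeta> ^ k * x k\<close>, expanding \<open>f\<^sup>(\<^sup>m\<^sup>) / (1 - cnj \<zeta> * z)\<close> in powers of \<open>z\<close> turns
  \<open>D(f)\<close> into a weighted \<open>l\<^sup>2\<close> norm of the sums \<open>\<Sum>i\<le>n. (i choose m) * x i\<close>. In terms of the tails
  \<open>b\<close> of the coefficients, \<open>x i = b (i - 1) - b i\<close>, finiteness of \<open>\<Sum>k. (k choose (m - 1)) * (b k)\<^sup>2\<close>
  implies finiteness of \<open>D(f)\<close>.

  The differences \<open>d\<close> of the Cesaro numbers of order 1/2 satisfy \<open>d\<^sub>j\<^sup>2 \<ge> 1 / (4 * (j + 1))\<close>, so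
  \<open>\<Sum>d\<^sub>j\<^sup>2\<close> diverges. Take \<open>b\<close> proportional to \<open>d (2 * N - j)\<close> on very sparse blocks \<open>N < j \<le> 2 * N\<close>,
  normalised to have small norm but \<open>N powr ((m - 1) / 2) * (\<Sum>j. d (2 * N - j) * b j) = 1\<close>. Since \<open>b \<ge> 0\<close>,
  summation by parts shows without any cancellation that the sums belonging to
  \<open>\<sigma>\<^sub>n f - f\<close>, \<open>n = 2 * N\<close>, are large for all indices in the gap after the block, which keeps
  \<open>D(\<sigma>\<^sub>n f - f)\<close> away from \<open>0\<close>.
\<close>

subsection \<open>Lebesgue measure on the unit disc\<close>

lemma distr_lborel_rotation:
  fixes \<omega> :: complex
  assumes "norm \<omega> = 1"
  shows "distr lborel borel ((*) \<omega>) = lborel"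
proof -
  \<comment> \<open>\<open>\<phi>\<close> identifies \<open>real^2\<close> with the complex plane,
    so that invariance under orthogonal maps of \<open>real^2\<close> can be used. In these
    coordinates \<open>\<rho>\<close> is multiplication by \<open>cnj \<omega>\<close>, the inverse
    rotation.\<close>
  define \<phi> :: "real^2 \<Rightarrow> complex" where "\<phi> v = Complex (v $ 1) (v $ 2)" for v
  define \<rho> :: "real^2 \<Rightarrow> real^2" where
    "\<rho> v = vector [Re \<omega> * v $ 1 + Im \<omega> * v $ 2, Re \<omega> * v $ 2 - Im \<omega> * v $ 1]" for v
  have \<omega>: "(Re \<omega>)\<^sup>2 + (Im \<omega>)\<^sup>2 = 1"
    using assms by (simp add: cmod_def)
  have [measurable]: "\<phi> \<in> borel_measurable borel"
    by (intro borel_measurable_continuous_onI) (auto simp: \<phi>_def Complex_eq intro!: continuous_intros)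
  have basis: "(Basis :: (real^2) set) = {axis 1 1, axis 2 1}"
    by (auto simp: Basis_vec_def UNIV_2)
  have ne: "axis 1 1 \<noteq> (axis 2 1 :: real^2)"
    by (simp add: axis_eq_axis)
  have vim: "\<phi> -` box l u = box (vector [Re l, Im l]) (vector [Re u, Im u])" for l u
    by (auto simp: \<phi>_def mem_box_cart forall_2 vector_2 in_box_complex_iff)
  have \<phi>: "lborel = distr lborel borel \<phi>"
  proof (rule lborel_eqI)
    fix l u :: complex assume le: "\<And>b. b \<in> Basis \<Longrightarrow> l \<bullet> b \<le> u \<bullet> b"
    have "emeasure (distr lborel borel \<phi>) (box l u) = emeasure lborel (\<phi> -` box l u)"
      by (subst emeasure_distr) auto
    also have "\<dots> = ennreal (\<Prod>b\<in>Basis. (u - l) \<bullet> b)"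
      unfolding vim using le[of 1] le[of \<i>] ne
      by (subst emeasure_lborel_box)
        (auto simp: basis inner_axis vector_2 Basis_complex_def)
    finally show "emeasure (distr lborel borel \<phi>) (box l u) = ennreal (\<Prod>b\<in>Basis. (u - l) \<bullet> b)" .
  qed auto
  have sq: "(norm v)\<^sup>2 = (v $ 1)\<^sup>2 + (v $ 2)\<^sup>2" for v :: "real^2"
    by (simp add: norm_vec_def L2_set_def UNIV_2)
  have orth: "orthogonal_transformation \<rho>"
    unfolding orthogonal_transformation
  proof (intro conjI allI)
    show "linear \<rho>"
      by (intro linearI) (auto simp: \<rho>_def vec_eq_iff forall_2 vector_2 algebra_simps)
    fix v
    have "(norm (\<rho> v))\<^sup>2 = ((Re \<omega>)\<^sup>2 + (Im \<omega>)\<^sup>2) * (norm v)\<^sup>2"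
      unfolding sq by (simp add: \<rho>_def vector_2 power2_eq_square algebra_simps)
    then show "norm (\<rho> v) = norm v"
      by (simp add: \<omega>)
  qed
  \<comment> \<open>A preimage under the rotation is rewritten as an image under the inverse
    rotation, the form to which \<open>measure_orthogonal_image\<close> applies.\<close>
  have im: "\<phi> -` ((*) \<omega> -` B) = \<rho> ` (\<phi> -` B)" for B
  proof (rule set_eqI, rule iffI)
    fix v assume "v \<in> \<phi> -` ((*) \<omega> -` B)"
    moreover define w :: "real^2" where "w = vector [Re (\<omega> * \<phi> v), Im (\<omega> * \<phi> v)]"
    have "\<phi> w = \<omega> * \<phi> v" by (simp add: \<phi>_def w_def vector_2 complex_eq_iff)
    moreover have "\<rho> w = v"
    proof -
      have "\<rho> w $ i = ((Re \<omega>)\<^sup>2 + (Im \<omega>)\<^sup>2) * v $ i" for i :: 2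
        using exhaust_2[of i] by (auto simp: \<rho>_def w_def \<phi>_def vector_2 power2_eq_square algebra_simps)
      then show ?thesis by (simp add: \<omega> vec_eq_iff)
    qed
    ultimately show "v \<in> \<rho> ` (\<phi> -` B)" by (metis imageI vimage_eq)
  next
    fix v assume "v \<in> \<rho> ` (\<phi> -` B)"
    then obtain w where w: "v = \<rho> w" "\<phi> w \<in> B" by auto
    have "\<omega> * \<phi> (\<rho> w) = of_real ((Re \<omega>)\<^sup>2 + (Im \<omega>)\<^sup>2) * \<phi> w"
      by (simp add: \<rho>_def \<phi>_def vector_2 complex_eq_iff power2_eq_square algebra_simps)
    then show "v \<in> \<phi> -` ((*) \<omega> -` B)" using w by (simp add: \<omega>)
  qed
  have "lborel = distr lborel borel ((*) \<omega>)"
  proof (rule lborel_eqI)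
    fix l u :: complex assume le: "\<And>b. b \<in> Basis \<Longrightarrow> l \<bullet> b \<le> u \<bullet> b"
    have meas [measurable]: "(*) \<omega> \<in> borel_measurable borel" by simp
    let ?B = "\<phi> -` box l u"
    have B: "?B \<in> lmeasurable" by (simp add: vim)
    have sB: "(*) \<omega> -` box l u \<in> sets borel" "\<rho> ` ?B \<in> sets borel"
      subgoal using measurable_sets[OF meas, of "box l u"] by simp
      subgoal
        using measurable_sets[of \<phi> borel borel "(*) \<omega> -` box l u"] measurable_sets[OF meas, of "box l u"]
        by (simp flip: im)
      done
    have "emeasure (distr lborel borel ((*) \<omega>)) (box l u) = emeasure (distr lborel borel \<phi>) ((*) \<omega> -` box l u)"
      by (subst emeasure_distr) (auto simp flip: \<phi>)
    also have "\<dots> = emeasure lborel (\<rho> ` ?B)"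
      using sB by (subst emeasure_distr) (auto simp: im)
    also have "\<dots> = emeasure lebesgue (\<rho> ` ?B)"
      using sB by simp
    also have "\<dots> = measure lebesgue (\<rho> ` ?B)"
      using measurable_orthogonal_image[OF orth B] by (simp add: emeasure_eq_measure2)
    also have "\<dots> = measure lebesgue ?B"
      by (simp only: measure_orthogonal_image[OF orth B])
    also have "\<dots> = emeasure lebesgue ?B"
      using B by (simp add: emeasure_eq_measure2)
    also have "\<dots> = emeasure lborel ?B"
      by (simp add: vim)
    also have "\<dots> = emeasure (distr lborel borel \<phi>) (box l u)"
      by (subst emeasure_distr) auto
    also have "\<dots> = ennreal (\<Prod>b\<in>Basis. (u - l) \<bullet> b)"
      using le by (simp flip: \<phi> add: emeasure_lborel_box)
    finally show "emeasure (distr lborel borel ((*) \<omega>)) (box l u) = ennreal (\<Prod>b\<in>Basis. (u - l) \<bullet> b)" .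
  qed auto
  then show ?thesis by simp
qed

section \<open>Normalised area measure on the disc and its radial moments\<close>

abbreviation disc_measure :: "complex measure" where
  "disc_measure \<equiv> uniform_measure lborel (ball 0 1)"

lemma emeasure_lborel_unit_disc: "emeasure lborel (ball (0::complex) 1) = ennreal pi"
  by (simp add: emeasure_ball unit_ball_vol_2)

lemma prob_space_disc_measure: "prob_space disc_measure"
  by (rule prob_space_uniform_measure) (auto simp: emeasure_lborel_unit_disc)

lemma AE_disc_measure: "AE z in disc_measure. norm z < 1"
proof -
  have "emeasure disc_measure {z. norm z < 1} = 1"
    using emeasure_lborel_unit_disc
    by (subst emeasure_uniform_measure) (auto simp: ball_def divide_eq_1_ennreal Collect_conj_eq[symmetric])
  then show ?thesis
    by (subst prob_space.AE_iff_emeasure_eq_1[OF prob_space_disc_measure]) auto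
qed

text \<open>A disc of radius \<open>sqrt t\<close> has normalised area \<open>t\<close>, so the
  squared modulus is uniformly distributed on \<open>{0..1}\<close>. Radial integrals thereby become
  integrals over the unit interval.\<close>

lemma disc_measure_norm_square_le:
  assumes "0 \<le> t" "t \<le> 1"
  shows "measure disc_measure {z. (norm z)\<^sup>2 \<le> t} = t"
proof -
  have eq: "{z::complex. (norm z)\<^sup>2 \<le> t} = cball 0 (sqrt t)"
    using assms by (auto simp: real_le_rsqrt real_sqrt_le_iff sqrt_le_D)
      (metis norm_ge_zero power_mono real_sqrt_pow2)
  have mass: "emeasure lborel (ball 0 1 \<inter> cball (0::complex) (sqrt t)) = ennreal (pi * t)"
  \<comment> \<open>Only for \<open>t = 1\<close> does the closed disc stick out of the open unit
    disc.\<close>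
  proof (cases "t = 1")
    case True
    then have "ball 0 1 \<inter> cball (0::complex) (sqrt t) = ball 0 1" by auto
    then show ?thesis using True emeasure_lborel_unit_disc by simp
  next
    case False
    then have "sqrt t < 1" using assms by simp
    then have "norm z < 1" if "norm z \<le> sqrt t" for z :: complex
      using that by linarith
    then have "ball 0 1 \<inter> cball (0::complex) (sqrt t) = cball 0 (sqrt t)" by auto
    then show ?thesis
      using assms by (simp add: emeasure_cball unit_ball_vol_2)
  qed
  show ?thesis
    unfolding eq using assms mass emeasure_lborel_unit_disc
    by (subst measure_uniform_measure) (auto simp: measure_def)
qed

lemma nn_integral_disc_measure_radial:
  assumes [measurable]: "h \<in> borel_measurable (borel :: real measure)"
  shows "(\<integral>\<^sup>+z. h ((norm z)\<^sup>2) \<partial>disc_measure) = (\<integral>\<^sup>+x. indicator {0..1} x * h x \<partial>lborel)"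
proof -
  interpret prob_space disc_measure by (rule prob_space_disc_measure)
  have "distributed disc_measure lborel (\<lambda>z. (norm z)\<^sup>2) (\<lambda>x. indicator {0..1} x / measure lborel {0..1::real})"
    by (rule uniform_distrI_borel_atLeastAtMost) (auto simp: disc_measure_norm_square_le)
  from distributed_nn_integral[OF this, of h] show ?thesis
    by (simp add: ennreal_indicator)
qed

text \<open>This is the Beta value at \<open>k + 1\<close> and \<open>m + 1\<close>, the squared
  norm of \<open>z ^ k\<close> in the Bergman space with weight
  \<open>(1 - (norm z)\<^sup>2) ^ m\<close>.\<close>

definition disc_moment :: "nat \<Rightarrow> nat \<Rightarrow> real" where
  "disc_moment m k = fact k * fact m / fact (k + m + 1)"

lemma disc_moment_pos: "disc_moment m k > 0"
  by (simp add: disc_moment_def)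

lemma has_integral_power_mult_power:
  "((\<lambda>x. x ^ k * (1 - x) ^ m) has_integral disc_moment m k) {0..1::real}"
proof -
  have "((\<lambda>t. t powr (real (k+1) - 1) * (1 - t) powr (real (m+1) - 1)) has_integral Beta (real (k+1)) (real (m+1))) {0..1}"
    by (rule has_integral_Beta_real) auto
  moreover have "Beta (real (k+1)) (real (m+1)) = disc_moment m k"
    using Gamma_fact[of k, where 'a = real] Gamma_fact[of m, where 'a = real] Gamma_fact[of "k+m+1", where 'a = real]
    by (simp add: Beta_def disc_moment_def add_ac)
  ultimately have "((\<lambda>t. t powr real k * (1 - t) powr real m) has_integral disc_moment m k) {0..1}"
    by simp
  \<comment> \<open>Since \<open>0 powr 0 = 0\<close> but \<open>0 ^ 0 = 1\<close>, real exponents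
    are exchanged for natural ones on the open interval, where both powers agree.\<close>
  then have "((\<lambda>t. t powr real k * (1 - t) powr real m) has_integral disc_moment m k) {0<..<1}"
    by (simp add: has_integral_Icc_iff_Ioo)
  then have "((\<lambda>t. t ^ k * (1 - t) ^ m) has_integral disc_moment m k) {0<..<1::real}"
    by (rule has_integral_eq[rotated]) (auto simp: powr_realpow)
  then show ?thesis by (simp add: has_integral_Icc_iff_Ioo)
qed

lemma nn_integral_disc_measure_moment:
  "(\<integral>\<^sup>+z. ennreal ((norm z) ^ (2 * k) * (1 - (norm z)\<^sup>2) ^ m) \<partial>disc_measure)
     = ennreal (disc_moment m k)"
proof -
  have "(\<integral>\<^sup>+z. ennreal ((norm z) ^ (2 * k) * (1 - (norm z)\<^sup>2) ^ m) \<partial>disc_measure)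
     = (\<integral>\<^sup>+x. indicator {0..1} x * ennreal (x ^ k * (1 - x) ^ m) \<partial>lborel)"
    by (subst nn_integral_disc_measure_radial[symmetric]) (auto simp: power_mult)
  also have "\<dots> = (\<integral>\<^sup>+x. ennreal (indicator {0..1} x * (x ^ k * (1 - x) ^ m)) \<partial>lborel)"
    by (intro nn_integral_cong) (auto split: split_indicator)
  also have "\<dots> = ennreal (disc_moment m k)"
    by (rule nn_integral_has_integral_lebesgue[OF _ has_integral_power_mult_power]) auto
  finally show ?thesis .
qed

lemma disc_measure_density: "disc_measure = density lborel (\<lambda>z. ennreal (indicator (ball 0 1) z / pi))"
  unfolding uniform_measure_def emeasure_lborel_unit_disc
  by (intro arg_cong[where f = "density lborel"] ext) (simp add: divide_ennreal flip: ennreal_indicator)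

section \<open>Orthogonality of monomials and Parseval estimates\<close>

lemma integral_disc_measure_rotation:
  fixes h :: "complex \<Rightarrow> complex"
  assumes "norm \<omega> = 1" and [measurable]: "h \<in> borel_measurable borel"
  shows "(\<integral>z. h (\<omega> * z) \<partial>disc_measure) = (\<integral>z. h z \<partial>disc_measure)"
proof -
  have [measurable]: "(*) \<omega> \<in> borel_measurable borel" by simp
  have "(\<integral>z. (indicator (ball 0 1) z / pi) *\<^sub>R h z \<partial>lborel)
      = (\<integral>z. (indicator (ball 0 1) z / pi) *\<^sub>R h z \<partial>distr lborel borel ((*) \<omega>))"
    by (simp add: distr_lborel_rotation assms)
  also have "\<dots> = (\<integral>z. (indicator (ball 0 1) (\<omega> * z) / pi) *\<^sub>R h (\<omega> * z) \<partial>lborel)"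
    by (rule integral_distr) (measurable, auto)
  also have "\<dots> = (\<integral>z. (indicator (ball 0 1) z / pi) *\<^sub>R h (\<omega> * z) \<partial>lborel)"
    using assms(1) by (intro Bochner_Integration.integral_cong) (auto simp: norm_mult split: split_indicator)
  moreover have "(\<integral>z. f z \<partial>disc_measure) = (\<integral>z. (indicator (ball 0 1) z / pi) *\<^sub>R f z \<partial>lborel)"
    if "f \<in> borel_measurable borel" for f :: "complex \<Rightarrow> complex"
    unfolding disc_measure_density using that by (intro integral_density borel_measurable_divide borel_measurable_indicator) auto
  ultimately show ?thesis by simp
qed

text \<open>Rotating by \<open>\<omega>\<close> multiplies the integral by \<open>\<omega>\<^sup>j / \<omega>\<^sup>k\<close>, so it vanishes.\<close>
lemma integral_disc_measure_monomials_orthogonal: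
  assumes "j \<noteq> k" and [measurable]: "\<phi> \<in> borel_measurable (borel :: real measure)"
  shows "(\<integral>z. z ^ j * cnj z ^ k * complex_of_real (\<phi> (norm z)) \<partial>disc_measure) = 0"
proof -
  \<comment> \<open>The angle is chosen to make \<open>\<omega> ^ j * cnj \<omega> ^ k = -1\<close>;
    the integral then equals its own negative.\<close>
  define \<omega> where "\<omega> = cis (pi / (real j - real k))"
  let ?h = "\<lambda>z. z ^ j * cnj z ^ k * complex_of_real (\<phi> (norm z))"
  let ?I = "\<integral>z. ?h z \<partial>disc_measure"
  have [measurable]: "cnj \<in> borel_measurable borel"
    by (intro borel_measurable_continuous_onI continuous_intros)
  have "?I = (\<integral>z. ?h (\<omega> * z) \<partial>disc_measure)"
    by (rule integral_disc_measure_rotation[symmetric]) (auto simp: \<omega>_def)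
  also have "\<dots> = (\<integral>z. (\<omega> ^ j * cnj \<omega> ^ k) * ?h z \<partial>disc_measure)"
    by (simp add: power_mult_distrib norm_mult \<omega>_def mult_ac)
  also have "\<dots> = (\<omega> ^ j * cnj \<omega> ^ k) * ?I" by simp
  finally have eq: "?I = (\<omega> ^ j * cnj \<omega> ^ k) * ?I" .
  have "real j * pi / (real j - real k) - real k * pi / (real j - real k) = pi"
    using assms(1) by (simp flip: diff_divide_distrib left_diff_distrib)
  then have "\<omega> ^ j * cnj \<omega> ^ k = -1"
    using assms(1) by (simp add: \<omega>_def cis_cnj Complex.DeMoivre cis_mult)
  then show ?thesis using eq by simp
qed

text \<open>Parseval's identity: the squared modulus expands into a double sum of
  \<open>z ^ j * cnj z ^ k\<close>, rotation removes the terms with \<open>j \<noteq> k\<close>, and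
  the diagonal terms are moments.\<close>

lemma nn_integral_disc_measure_polynomial:
  fixes c :: "nat \<Rightarrow> complex"
  assumes "finite A"
  shows "(\<integral>\<^sup>+z. ennreal ((norm (\<Sum>k\<in>A. c k * z ^ k))\<^sup>2 * (1 - (norm z)\<^sup>2) ^ m) \<partial>disc_measure)
     = ennreal (\<Sum>k\<in>A. (norm (c k))\<^sup>2 * disc_moment m k)"
proof -
  interpret prob_space disc_measure by (rule prob_space_disc_measure)
  define w where "w z = (1 - (norm z)\<^sup>2) ^ m" for z :: complex
  \<comment> \<open>The weight is evaluated at \<open>norm z\<close>, because the orthogonality of
    monomials is stated for functions of the modulus.\<close>
  define t where "t j k z = z ^ j * cnj z ^ k * complex_of_real (w (of_real (norm z)))" for j k z
  let ?P = "\<lambda>z. \<Sum>k\<in>A. c k * z ^ k"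
  have [measurable]: "cnj \<in> borel_measurable borel" "w \<in> borel_measurable borel"
    unfolding w_def by (intro borel_measurable_continuous_onI continuous_intros)+
  have w: "0 \<le> w z" "w z \<le> 1" if "norm z < 1" for z
    using that by (auto simp: w_def power_le_one power2_le_iff_abs_le abs_square_le_1 intro!: power_le_one zero_le_power)
  have wn: "w (complex_of_real (norm z)) = w z" for z by (simp add: w_def)
  have int: "integrable disc_measure (t j k)" for j k
  proof (rule integrable_const_bound[where B = 1])
    show "AE z in disc_measure. norm (t j k z) \<le> 1"
      using AE_disc_measure
    proof eventually_elim
      case (elim z)
      then have "norm (t j k z) \<le> 1 * 1 * 1"
        unfolding t_def norm_mult norm_power wn using w[OF elim]
        by (intro mult_mono power_le_one) auto
      then show ?case by simp
    qed
  qed (unfold t_def, measurable)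
  have expand: "complex_of_real ((norm (?P z))\<^sup>2 * w z) = (\<Sum>j\<in>A. \<Sum>k\<in>A. c j * cnj (c k) * t j k z)" for z
    unfolding of_real_mult complex_norm_square cnj_sum sum_product wn t_def
    by (simp add: sum_distrib_right sum_distrib_left mult_ac)
  have diag: "(\<integral>z. t k k z \<partial>disc_measure) = of_real (disc_moment m k)" for k
  proof -
    have "z ^ k * cnj z ^ k = of_real ((norm z) ^ (2 * k))" for z
      by (metis complex_norm_square of_real_power power_mult power_mult_distrib)
    then have "t k k z = of_real ((norm z) ^ (2 * k) * (1 - (norm z)\<^sup>2) ^ m)" for z
      by (simp add: t_def wn w_def)
    moreover have "has_bochner_integral disc_measure (\<lambda>z. (norm z) ^ (2 * k) * (1 - (norm z)\<^sup>2) ^ m)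
        (disc_moment m k)"
      using AE_disc_measure w
      by (intro has_bochner_integral_nn_integral nn_integral_disc_measure_moment)
        (auto simp: w_def less_imp_le[OF disc_moment_pos] elim!: eventually_mono)
    ultimately show ?thesis
      by (simp only: has_bochner_integral_integral_eq integral_complex_of_real)
  qed
  have offdiag: "(\<integral>z. t j k z \<partial>disc_measure) = 0" if "j \<noteq> k" for j k
    unfolding t_def using that
    by (intro integral_disc_measure_monomials_orthogonal[where \<phi> = "\<lambda>r. w (of_real r)"]) measurable
  have "of_real (\<integral>z. (norm (?P z))\<^sup>2 * w z \<partial>disc_measure)
      = (\<integral>z. complex_of_real ((norm (?P z))\<^sup>2 * w z) \<partial>disc_measure)"
    by (rule integral_complex_of_real[symmetric])
  also have "\<dots> = (\<Sum>j\<in>A. \<Sum>k\<in>A. c j * cnj (c k) * (\<integral>z. t j k z \<partial>disc_measure))"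
    unfolding expand using int by (simp add: integral_sum Bochner_Integration.integral_sum)
  also have "\<dots> = (\<Sum>j\<in>A. \<Sum>k\<in>A. if k = j then c j * cnj (c j) * (\<integral>z. t j j z \<partial>disc_measure) else 0)"
    by (intro sum.cong refl) (auto simp: offdiag)
  also have "\<dots> = (\<Sum>j\<in>A. of_real ((norm (c j))\<^sup>2 * disc_moment m j))"
    using assms by (simp add: diag flip: complex_norm_square)
  finally have integral: "(\<integral>z. (norm (?P z))\<^sup>2 * w z \<partial>disc_measure)
      = (\<Sum>j\<in>A. (norm (c j))\<^sup>2 * disc_moment m j)"
    by (simp only: flip: of_real_sum) (simp only: of_real_eq_iff)
  have "integrable disc_measure (\<lambda>z. complex_of_real ((norm (?P z))\<^sup>2 * w z))"
    unfolding expand using int by simp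
  then have "integrable disc_measure (\<lambda>z. (norm (?P z))\<^sup>2 * w z)"
    by (simp only: complex_of_real_integrable_eq)
  then have "(\<integral>\<^sup>+z. ennreal ((norm (?P z))\<^sup>2 * w z) \<partial>disc_measure)
      = ennreal (\<integral>z. (norm (?P z))\<^sup>2 * w z \<partial>disc_measure)"
    using AE_disc_measure w by (intro nn_integral_eq_integral) (auto elim!: eventually_mono)
  then show ?thesis unfolding integral by (simp add: w_def)
qed

text \<open>Fatou's lemma for the partial sums.\<close>
lemma nn_integral_disc_measure_power_series_le:
  fixes c :: "nat \<Rightarrow> complex"
  assumes "\<And>z. norm z < 1 \<Longrightarrow> (\<lambda>k. c k * z ^ k) sums g z"
    and "summable (\<lambda>k. (norm (c k))\<^sup>2 * disc_moment m k)"
  shows "(\<integral>\<^sup>+z. ennreal ((norm (g z))\<^sup>2 * (1 - (norm z)\<^sup>2) ^ m) \<partial>disc_measure)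
     \<le> ennreal (\<Sum>k. (norm (c k))\<^sup>2 * disc_moment m k)"
    (is "?I \<le> _")
proof -
  let ?S = "\<lambda>n z. \<Sum>k<n. c k * z ^ k"
  have "?I = (\<integral>\<^sup>+z. liminf (\<lambda>n. ennreal ((norm (?S n z))\<^sup>2 * (1 - (norm z)\<^sup>2) ^ m)) \<partial>disc_measure)"
  proof (rule nn_integral_cong_AE)
    show "AE z in disc_measure. ennreal ((norm (g z))\<^sup>2 * (1 - (norm z)\<^sup>2) ^ m)
       = liminf (\<lambda>n. ennreal ((norm (?S n z))\<^sup>2 * (1 - (norm z)\<^sup>2) ^ m))"
      using AE_disc_measure
    proof eventually_elim
      case (elim z)
      then have "(\<lambda>n. ?S n z) \<longlonglongrightarrow> g z" using assms(1) by (simp add: sums_def)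
      then have "(\<lambda>n. ennreal ((norm (?S n z))\<^sup>2 * (1 - (norm z)\<^sup>2) ^ m)) \<longlonglongrightarrow> ennreal ((norm (g z))\<^sup>2 * (1 - (norm z)\<^sup>2) ^ m)"
        by (intro tendsto_intros)
      then show ?case by (rule lim_imp_Liminf[symmetric, rotated]) simp
    qed
  qed
  also have "\<dots> \<le> liminf (\<lambda>n. \<integral>\<^sup>+z. ennreal ((norm (?S n z))\<^sup>2 * (1 - (norm z)\<^sup>2) ^ m) \<partial>disc_measure)"
    by (rule nn_integral_liminf) measurable
  also have "\<dots> \<le> ennreal (\<Sum>k. (norm (c k))\<^sup>2 * disc_moment m k)"
    unfolding nn_integral_disc_measure_polynomial[OF finite_lessThan]
    using assms(2) by (intro Liminf_le always_eventually allI ennreal_leI sum_le_suminf) (auto simp: less_imp_le[OF disc_moment_pos])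
  finally show ?thesis .
qed

text \<open>A partial sum is \<open>g\<close> minus a remainder, and the remainder is controlled by
  the upper estimate, which tends to 0. The factor 2 comes from splitting the square of this
  difference; it is harmless for bounding integrals away from 0.\<close>

lemma nn_integral_disc_measure_power_series_ge:
  fixes c :: "nat \<Rightarrow> complex"
  assumes sums: "\<And>z. norm z < 1 \<Longrightarrow> (\<lambda>k. c k * z ^ k) sums g z"
    and summable: "summable (\<lambda>k. (norm (c k))\<^sup>2 * disc_moment m k)"
    and [measurable]: "g \<in> borel_measurable borel"
  shows "ennreal (\<Sum>k. (norm (c k))\<^sup>2 * disc_moment m k)
     \<le> 2 * (\<integral>\<^sup>+z. ennreal ((norm (g z))\<^sup>2 * (1 - (norm z)\<^sup>2) ^ m) \<partial>disc_measure)"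
    (is "_ \<le> 2 * ?I")
proof (cases "?I = \<infinity>")
  case True
  then show ?thesis by (simp add: ennreal_mult_top)
next
  case False
  then obtain i where i: "?I = ennreal i" "0 \<le> i" by (cases ?I) auto
  define v where "v k = (norm (c k))\<^sup>2 * disc_moment m k" for k
  define W where "W z = (1 - (norm z)\<^sup>2) ^ m" for z :: complex
  let ?S = "\<lambda>n z. \<Sum>k<n. c k * z ^ k"
  have v: "summable v" "v k \<ge> 0" for k
    using summable by (simp_all add: v_def[abs_def] less_imp_le[OF disc_moment_pos])
  have W: "0 \<le> W z" if "norm z < 1" for z
    using that by (auto simp: W_def power2_le_iff_abs_le abs_square_le_1 intro!: zero_le_power)
  have [measurable]: "W \<in> borel_measurable borel"
    unfolding W_def by (intro borel_measurable_continuous_onI continuous_intros)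
  have bound: "(\<Sum>k<n. v k) \<le> 2 * i + 2 * (suminf v - (\<Sum>k<n. v k))" for n
  proof -
    \<comment> \<open>Deleting the first \<open>n\<close> coefficients leaves the series of
      \<open>g - ?S n\<close>, whose integral is at most the tail of the convergent series.\<close>
    define c' where "c' k = (if k < n then 0 else c k)" for k
    have v': "(\<lambda>k. (norm (c' k))\<^sup>2 * disc_moment m k) = (\<lambda>k. if k < n then 0 else v k)"
      by (auto simp: c'_def v_def fun_eq_iff)
    have "(\<lambda>k. (if k < n then v k else 0) + (if k < n then 0 else v k)) = v"
      by auto
    moreover have "(\<lambda>k. if k < n then v k else 0) sums (\<Sum>k<n. v k)"
      using sums_If_finite_set[of "{..<n}" v] by simp
    ultimately have tail: "(\<lambda>k. if k < n then 0 else v k) sums (suminf v - (\<Sum>k<n. v k))"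
      using sums_diff[OF summable_sums[OF v(1)], of "\<lambda>k. if k < n then v k else 0" "\<Sum>k<n. v k"]
      by (simp add: if_distrib cong: if_cong)
    have "(\<lambda>k. c' k * z ^ k) sums (g z - ?S n z)" if "norm z < 1" for z
    proof -
      have "(\<lambda>k. if k < n then c k * z ^ k else 0) sums ?S n z"
        using sums_If_finite_set[of "{..<n}" "\<lambda>k. c k * z ^ k"] by simp
      from sums_diff[OF sums[OF that] this] show ?thesis
        by (rule back_subst[of "\<lambda>f. f sums _"]) (auto simp: c'_def fun_eq_iff)
    qed
    from nn_integral_disc_measure_power_series_le[OF this, of m]
    have R: "(\<integral>\<^sup>+z. ennreal ((norm (g z - ?S n z))\<^sup>2 * W z) \<partial>disc_measure) \<le> ennreal (suminf v - (\<Sum>k<n. v k))"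
      using tail by (simp add: v' sums_iff W_def)
    have "ennreal (\<Sum>k<n. v k) = (\<integral>\<^sup>+z. ennreal ((norm (?S n z))\<^sup>2 * W z) \<partial>disc_measure)"
      by (simp add: nn_integral_disc_measure_polynomial v_def W_def)
    also have "\<dots> \<le> (\<integral>\<^sup>+z. 2 * ennreal ((norm (g z))\<^sup>2 * W z) + 2 * ennreal ((norm (g z - ?S n z))\<^sup>2 * W z) \<partial>disc_measure)"
    proof (rule nn_integral_mono_AE)
      show "AE z in disc_measure. ennreal ((norm (?S n z))\<^sup>2 * W z)
          \<le> 2 * ennreal ((norm (g z))\<^sup>2 * W z) + 2 * ennreal ((norm (g z - ?S n z))\<^sup>2 * W z)"
        using AE_disc_measure
      proof eventually_elim
        case (elim z)
        have "norm (?S n z) \<le> norm (g z) + norm (g z - ?S n z)"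
          using norm_triangle_ineq4[of "g z" "g z - ?S n z"] by simp
        then have "(norm (?S n z))\<^sup>2 \<le> (norm (g z) + norm (g z - ?S n z))\<^sup>2"
          by (rule power_mono) simp
        also have "\<dots> \<le> 2 * (norm (g z))\<^sup>2 + 2 * (norm (g z - ?S n z))\<^sup>2"
          using sum_squares_bound[of "norm (g z)" "norm (g z - ?S n z)"] by (simp add: power2_sum)
        finally have "(norm (?S n z))\<^sup>2 * W z \<le> (2 * (norm (g z))\<^sup>2 + 2 * (norm (g z - ?S n z))\<^sup>2) * W z"
          using W[OF elim] by (rule mult_right_mono)
        then have "ennreal ((norm (?S n z))\<^sup>2 * W z)
            \<le> ennreal (2 * ((norm (g z))\<^sup>2 * W z) + 2 * ((norm (g z - ?S n z))\<^sup>2 * W z))"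
          by (intro ennreal_leI) (simp add: algebra_simps)
        also have "\<dots> = 2 * ennreal ((norm (g z))\<^sup>2 * W z) + 2 * ennreal ((norm (g z - ?S n z))\<^sup>2 * W z)"
          using W[OF elim] by (simp add: ennreal_plus ennreal_mult')
        finally show ?case .
      qed
    qed
    also have "\<dots> = 2 * ?I + 2 * (\<integral>\<^sup>+z. ennreal ((norm (g z - ?S n z))\<^sup>2 * W z) \<partial>disc_measure)"
      by (subst nn_integral_add) (auto simp: nn_integral_cmult W_def)
    also have "\<dots> \<le> 2 * ennreal i + 2 * ennreal (suminf v - (\<Sum>k<n. v k))"
      using R i by (intro add_mono mult_left_mono) auto
    also have "\<dots> = ennreal (2 * i + 2 * (suminf v - (\<Sum>k<n. v k)))"
    proof -
      have "0 \<le> suminf v - (\<Sum>k<n. v k)"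
        using v sum_le_suminf[of v "{..<n}"] by simp
      moreover have "2 * ennreal i + 2 * ennreal t = ennreal (2 * i + 2 * t)" if "0 \<le> t" for t
        using i(2) that by (simp add: ennreal_plus ennreal_mult')
      ultimately show ?thesis by blast
    qed
    finally show ?thesis
      using i v sum_le_suminf[of v "{..<n}"] by (subst (asm) ennreal_le_iff) auto
  qed
  have lim: "(\<lambda>n. \<Sum>k<n. v k) \<longlonglongrightarrow> suminf v"
    using v summable_LIMSEQ by blast
  have "suminf v \<le> 2 * i + 2 * (suminf v - suminf v)"
  proof (rule LIMSEQ_le[OF lim])
    show "(\<lambda>n. 2 * i + 2 * (suminf v - (\<Sum>k<n. v k))) \<longlonglongrightarrow> 2 * i + 2 * (suminf v - suminf v)"
      by (intro tendsto_intros lim)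
  qed (use bound in blast)
  then have "ennreal (suminf v) \<le> ennreal (2 * i)"
    by (intro ennreal_leI) simp
  then show ?thesis
    using i by (simp add: v_def[abs_def] ennreal_mult')
qed

subsection \<open>The Dirichlet integral of a power series\<close>

lemma fps_higher_deriv_nth:
  fixes F :: "'a :: field_char_0 fps"
  shows "fps_nth ((fps_deriv ^^ m) F) k = fact m * of_nat ((k + m) choose m) * fps_nth F (k + m)"
proof -
  have "fps_nth ((fps_deriv ^^ m) F) k = fact (k + m) / fact k * fps_nth F (k + m)"
  proof (induction m arbitrary: k)
    case (Suc m)
    have "fps_nth ((fps_deriv ^^ Suc m) F) k = of_nat (Suc k) * fps_nth ((fps_deriv ^^ m) F) (Suc k)"
      by simp
    also have "\<dots> = of_nat (Suc k) * (fact (Suc k + m) / fact (Suc k)) * fps_nth F (Suc k + m)"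
      unfolding Suc by simp
    also have "of_nat (Suc k) * (fact (Suc k + m) / fact (Suc k)) = (fact (k + Suc m) / fact k :: 'a)"
      unfolding fact_Suc[of k] by (simp del: of_nat_Suc fact_Suc)
    finally show ?case by simp
  qed simp
  then show ?thesis
    using binomial_fact[of m "k + m", where 'a = 'a] by simp
qed

lemma norm_less_fps_conv_radius:
  "norm z < 1 \<Longrightarrow> 1 \<le> fps_conv_radius F \<Longrightarrow> ereal (norm z) < fps_conv_radius F"
  by (rule less_le_trans[of _ 1]) auto

lemma higher_deriv_eval_fps:
  fixes F :: "complex fps"
  assumes "fps_conv_radius F \<ge> 1" "norm z < 1"
  shows "(deriv ^^ m) (eval_fps F) z = eval_fps ((fps_deriv ^^ m) F) z"
    and "fps_conv_radius ((fps_deriv ^^ m) F) \<ge> 1"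
proof -
  have r: "fps_conv_radius ((fps_deriv ^^ m) F) \<ge> 1" for m
    by (induction m) (auto intro: assms order.trans[OF _ fps_conv_radius_deriv])
  show "fps_conv_radius ((fps_deriv ^^ m) F) \<ge> 1" by (rule r)
  show "(deriv ^^ m) (eval_fps F) z = eval_fps ((fps_deriv ^^ m) F) z"
    using assms(2)
  proof (induction m arbitrary: z)
    case (Suc m)
    have "eventually (\<lambda>w. w \<in> ball 0 1) (nhds z)"
      using Suc.prems by (intro eventually_nhds_in_open) auto
    then have "eventually (\<lambda>w. (deriv ^^ m) (eval_fps F) w = eval_fps ((fps_deriv ^^ m) F) w) (nhds z)"
      by eventually_elim (use Suc.IH in auto)
    then have "deriv ((deriv ^^ m) (eval_fps F)) z = deriv (eval_fps ((fps_deriv ^^ m) F)) z"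
      by (rule deriv_cong_ev) simp
    also have "\<dots> = eval_fps (fps_deriv ((fps_deriv ^^ m) F)) z"
      by (intro DERIV_imp_deriv has_field_derivative_eval_fps norm_less_fps_conv_radius Suc.prems r)
    finally show ?case by simp
  qed simp
qed

definition weighted_sum :: "nat \<Rightarrow> (nat \<Rightarrow> real) \<Rightarrow> nat \<Rightarrow> real" where
  "weighted_sum m x n = (\<Sum>i\<le>n. real (i choose m) * x i)"

text \<open>The index is \<open>n = k + m\<close>, where \<open>k\<close> is the power of
  \<open>z\<close>; the denominator is then the reciprocal of \<open>disc_moment m k\<close>. For
  \<open>n < m\<close> the binomial is 0, and division by 0 makes the term 0.\<close>

definition dirichlet_term :: "nat \<Rightarrow> (nat \<Rightarrow> real) \<Rightarrow> nat \<Rightarrow> real" where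
  "dirichlet_term m x n = (weighted_sum m x n)\<^sup>2 / (real (n + 1) * real (n choose m))"

lemma dirichlet_term_nonneg: "dirichlet_term m x n \<ge> 0"
  by (simp add: dirichlet_term_def)

lemma dirichlet_term_eq_0: "n < m \<Longrightarrow> dirichlet_term m x n = 0"
  by (simp add: dirichlet_term_def)

lemma disc_moment_eq: "disc_moment m k = 1 / (real (k + m + 1) * real ((k + m) choose m))"
  by (simp add: disc_moment_def binomial_fact field_simps del: of_nat_Suc of_nat_add)

lemma dirichlet_term_sums_iff:
  "(\<lambda>k. dirichlet_term m x (k + m)) sums s \<longleftrightarrow> dirichlet_term m x sums s"
  using sums_iff_shift[of "dirichlet_term m x" m s] by (simp add: dirichlet_term_eq_0)

lemma fps_conv_radius_ge_1I:
  fixes F :: "complex fps"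
  assumes "\<And>z. norm z < 1 \<Longrightarrow> summable (\<lambda>k. fps_nth F k * z ^ k)"
  shows "fps_conv_radius F \<ge> 1"
  unfolding fps_conv_radius_def
proof (rule conv_radius_geI_ex')
  fix r :: real assume "0 < r" "ereal r < 1"
  then show "summable (\<lambda>n. fps_nth F n * of_real r ^ n)"
    by (intro assms) auto
qed

text \<open>Cauchy product of the derivative with the geometric series of
  \<open>1 / (1 - cnj \<zeta> * z)\<close>. The powers of \<open>cnj \<zeta>\<close> in each product
  combine to exponent \<open>k + m\<close>, so they factor out of the sum.\<close>

lemma power_series_higher_deriv_div:
  fixes x :: "nat \<Rightarrow> real"
  assumes \<zeta>: "norm \<zeta> = 1"
    and f: "\<And>z. norm z < 1 \<Longrightarrow> (\<lambda>k. of_real (x k) * cnj \<zeta> ^ k * z ^ k) sums f z"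
    and z: "norm z < 1"
  shows "(\<lambda>k. fact m * of_real (weighted_sum m x (k + m)) * cnj \<zeta> ^ (k + m) * z ^ k)
    sums ((deriv ^^ m) f z / (1 - cnj \<zeta> * z))"
proof -
  define F where "F = Abs_fps (\<lambda>k. of_real (x k) * cnj \<zeta> ^ k)"
  define G where "G = Abs_fps (\<lambda>k. cnj \<zeta> ^ k)"
  define H where "H = (fps_deriv ^^ m) F"
  have F: "fps_conv_radius F \<ge> 1"
    using f by (intro fps_conv_radius_ge_1I) (auto simp: F_def sums_iff)
  have Fz: "eval_fps F w = f w" if "norm w < 1" for w
    using f[OF that] by (simp add: eval_fps_def F_def sums_iff)
  have "eventually (\<lambda>w. w \<in> ball 0 1) (nhds z)"
    using z by (intro eventually_nhds_in_open) auto
  then have "eventually (\<lambda>w. f w = eval_fps F w) (nhds z)"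
    by eventually_elim (simp add: Fz)
  then have "(deriv ^^ m) f z = (deriv ^^ m) (eval_fps F) z"
    by (rule higher_deriv_cong_ev) simp
  also have "\<dots> = eval_fps H z"
    unfolding H_def by (rule higher_deriv_eval_fps[OF F z])
  finally have fH: "(deriv ^^ m) f z = eval_fps H z" .
  have H: "fps_conv_radius H \<ge> 1"
    unfolding H_def by (rule higher_deriv_eval_fps[OF F z])
  have Gs: "(\<lambda>k. fps_nth G k * w ^ k) sums (1 / (1 - cnj \<zeta> * w))" if "norm w < 1" for w
    using geometric_sums[of "cnj \<zeta> * w"] that \<zeta> by (simp add: G_def norm_mult power_mult_distrib)
  then have G: "fps_conv_radius G \<ge> 1"
    by (intro fps_conv_radius_ge_1I) (auto simp: sums_iff)
  have Gz: "eval_fps G z = 1 / (1 - cnj \<zeta> * z)"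
    using Gs[OF z] by (simp add: eval_fps_def sums_iff)
  have "1 \<le> fps_conv_radius (H * G)"
    using F G H by (intro order.trans[OF _ fps_conv_radius_mult]) auto
  then have "(\<lambda>k. fps_nth (H * G) k * z ^ k) sums eval_fps (H * G) z"
    using z by (intro sums_eval_fps) (auto intro: norm_less_fps_conv_radius)
  moreover have "eval_fps (H * G) z = (deriv ^^ m) f z / (1 - cnj \<zeta> * z)"
    using z H G by (subst eval_fps_mult) (auto simp: fH Gz intro: norm_less_fps_conv_radius)
  moreover have "fps_nth (H * G) k = fact m * of_real (weighted_sum m x (k + m)) * cnj \<zeta> ^ (k + m)" for k
  proof -
    have "weighted_sum m x (k + m) = (\<Sum>i\<in>{m..k+m}. real (i choose m) * x i)"
      unfolding weighted_sum_def by (rule sum.mono_neutral_right) auto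
    also have "\<dots> = (\<Sum>j\<le>k. real ((j + m) choose m) * x (j + m))"
      using sum.shift_bounds_cl_nat_ivl[of "\<lambda>i. real (i choose m) * x i" 0 m k]
      by (simp add: atMost_atLeast0 add.commute)
    finally have w: "weighted_sum m x (k + m) = (\<Sum>j\<le>k. real ((j + m) choose m) * x (j + m))" .
    have "fps_nth (H * G) k = (\<Sum>j\<le>k. fact m * of_nat ((j + m) choose m) * (of_real (x (j + m)) * cnj \<zeta> ^ (j + m)) * cnj \<zeta> ^ (k - j))"
      unfolding fps_mult_nth H_def fps_higher_deriv_nth by (simp add: F_def G_def atMost_atLeast0)
    also have "\<dots> = (\<Sum>j\<le>k. fact m * of_nat ((j + m) choose m) * of_real (x (j + m)) * cnj \<zeta> ^ (k + m))"
    proof (intro sum.cong refl)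
      fix j assume "j \<in> {..k}"
      then have "cnj \<zeta> ^ (j + m) * cnj \<zeta> ^ (k - j) = cnj \<zeta> ^ (k + m)"
        by (simp add: add.commute flip: power_add)
      then show "fact m * of_nat ((j + m) choose m) * (of_real (x (j + m)) * cnj \<zeta> ^ (j + m)) * cnj \<zeta> ^ (k - j)
          = fact m * of_nat ((j + m) choose m) * of_real (x (j + m)) * cnj \<zeta> ^ (k + m)"
        by (metis (no_types, lifting) mult.assoc)
    qed
    finally show ?thesis
      by (simp add: w sum_distrib_left sum_distrib_right mult_ac)
  qed
  ultimately show ?thesis by simp
qed

text \<open>For \<open>norm \<zeta> = 1\<close> the distance from \<open>z\<close> to
  \<open>\<zeta>\<close> is \<open>norm (1 - cnj \<zeta> * z)\<close>, so the integrand becomes the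
  squared modulus of the quotient series times \<open>(1 - (norm z)\<^sup>2) ^ m\<close>. The
  constant is \<open>(fact m)\<^sup>2 / (fact m * fact (m - 1)) = m\<close>.\<close>

lemma dirichlet_integral_power_series:
  fixes x :: "nat \<Rightarrow> real"
  assumes m: "m \<ge> 1" and \<zeta>: "norm \<zeta> = 1"
    and f: "\<And>z. norm z < 1 \<Longrightarrow> (\<lambda>k. of_real (x k) * cnj \<zeta> ^ k * z ^ k) sums f z"
    and x: "summable (dirichlet_term m x)"
  shows "dirichlet_integral \<zeta> m f \<le> ennreal (m * suminf (dirichlet_term m x))"
    and "ennreal (m * suminf (dirichlet_term m x)) \<le> 2 * dirichlet_integral \<zeta> m f"
proof -
  define c where "c k = fact m * of_real (weighted_sum m x (k + m)) * cnj \<zeta> ^ (k + m)" for k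
  define E where "E = Abs_fps c"
  \<comment> \<open>Extending the quotient by 0 outside the disc makes it Borel measurable, whatever
    values \<open>f\<close> takes there.\<close>
  define g where "g z = (if z \<in> ball 0 1 then eval_fps E z else 0)" for z
  have cs: "(\<lambda>k. c k * z ^ k) sums ((deriv ^^ m) f z / (1 - cnj \<zeta> * z))" if "norm z < 1" for z
    unfolding c_def by (rule power_series_higher_deriv_div[OF \<zeta> f that])
  have g: "g z = (deriv ^^ m) f z / (1 - cnj \<zeta> * z)" if "norm z < 1" for z
    using cs[OF that] that by (simp add: g_def E_def eval_fps_def sums_iff)
  have E: "fps_conv_radius E \<ge> 1"
    using cs by (intro fps_conv_radius_ge_1I) (auto simp: E_def sums_iff)
  have gsums: "(\<lambda>k. c k * z ^ k) sums g z" if "norm z < 1" for z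
    using cs[OF that] g[OF that] by simp
  have gm: "g \<in> borel_measurable borel"
    unfolding g_def
  proof (rule borel_measurable_continuous_on_if)
    show "continuous_on (ball 0 1) (eval_fps E)"
      using E by (intro continuous_on_subset[OF continuous_on_eval_fps]) (auto intro: norm_less_fps_conv_radius)
  qed auto
  have "norm (c k) = fact m * \<bar>weighted_sum m x (k + m)\<bar>" for k
    using \<zeta> by (simp add: c_def norm_mult norm_power)
  then have ct: "(norm (c k))\<^sup>2 * disc_moment m k = (fact m)\<^sup>2 * dirichlet_term m x (k + m)" for k
    by (simp add: disc_moment_eq dirichlet_term_def power_mult_distrib add_ac)
  have "(\<lambda>k. (fact m)\<^sup>2 * dirichlet_term m x (k + m)) sums ((fact m)\<^sup>2 * suminf (dirichlet_term m x))"
    using summable_sums[OF x] by (intro sums_mult) (simp add: dirichlet_term_sums_iff)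
  then have sm: "summable (\<lambda>k. (norm (c k))\<^sup>2 * disc_moment m k)"
    and sum: "(\<Sum>k. (norm (c k))\<^sup>2 * disc_moment m k) = (fact m)\<^sup>2 * suminf (dirichlet_term m x)"
    unfolding ct by (auto simp: sums_iff)
  let ?I = "\<integral>\<^sup>+z. ennreal ((norm (g z))\<^sup>2 * (1 - (norm z)\<^sup>2) ^ m) \<partial>disc_measure"
  have D: "dirichlet_integral \<zeta> m f = ennreal (1 / (fact m * fact (m - 1))) * ?I"
    unfolding dirichlet_integral_def
  proof (rule arg_cong[where f = "\<lambda>t. _ * t"], rule nn_integral_cong_AE)
    show "AE z in disc_measure. ennreal ((norm ((deriv ^^ m) f z))\<^sup>2 * ((1 - (norm z)\<^sup>2) / (norm (z - \<zeta>))\<^sup>2) * (1 - (norm z)\<^sup>2) ^ (m - 1))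
        = ennreal ((norm (g z))\<^sup>2 * (1 - (norm z)\<^sup>2) ^ m)"
      using AE_disc_measure
    proof eventually_elim
      case (elim z)
      have "cnj \<zeta> * (\<zeta> - z) = 1 - cnj \<zeta> * z"
        using \<zeta> complex_norm_square[of \<zeta>] by (simp add: algebra_simps)
      then have "norm (1 - cnj \<zeta> * z) = norm (z - \<zeta>)"
        using \<zeta> by (metis complex_mod_cnj mult_1 norm_minus_commute norm_mult)
      moreover have "(1 - (norm z)\<^sup>2) ^ m = (1 - (norm z)\<^sup>2) * (1 - (norm z)\<^sup>2) ^ (m - 1)"
        using m by (simp flip: power_Suc)
      ultimately show ?case
        by (simp add: g[OF elim] norm_divide power_divide mult.assoc)
    qed
  qed
  have const: "1 / (fact m * fact (m - 1)) * ((fact m)\<^sup>2 * t) = m * t" for t :: real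
    using m fact_reduce[of m, where 'a = real] by (simp add: power2_eq_square)
  have pos: "suminf (dirichlet_term m x) \<ge> 0"
    by (intro suminf_nonneg x dirichlet_term_nonneg)
  have eq: "ennreal (m * suminf (dirichlet_term m x)) = ennreal (1 / (fact m * fact (m - 1))) * ennreal ((fact m)\<^sup>2 * suminf (dirichlet_term m x))"
    using pos unfolding const[symmetric] by (intro ennreal_mult) auto
  show "dirichlet_integral \<zeta> m f \<le> ennreal (m * suminf (dirichlet_term m x))"
    unfolding D eq
    using nn_integral_disc_measure_power_series_le[OF gsums sm]
    by (intro mult_left_mono) (auto simp: sum)
  show "ennreal (m * suminf (dirichlet_term m x)) \<le> 2 * dirichlet_integral \<zeta> m f"
    unfolding D eq mult.left_commute[of 2]
    using nn_integral_disc_measure_power_series_ge[OF gsums sm gm]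
    by (intro mult_left_mono) (auto simp: sum)
qed

section \<open>Summation by parts and a Hardy-type identity\<close>

lemma sum_by_parts:
  fixes v b :: "nat \<Rightarrow> 'a :: comm_ring_1"
  assumes "v 0 = 0" and x: "\<And>i. i \<ge> 1 \<Longrightarrow> x i = b (i - 1) - b i"
  shows "(\<Sum>i\<le>n. v i * x i) = (\<Sum>i<n. b i * (v (Suc i) - v i)) - v n * b n"
proof (induction n)
  case (Suc n)
  moreover have "x (Suc n) = b n - b (Suc n)" using x[of "Suc n"] by simp
  ultimately show ?case by (simp only: sum.atMost_Suc sum.lessThan_Suc) (simp add: algebra_simps)
qed (use assms in simp)

context
  fixes m :: nat and b x :: "nat \<Rightarrow> real"
  assumes m: "m \<ge> 1" and x: "\<And>i. i \<ge> 1 \<Longrightarrow> x i = b (i - 1) - b i"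
begin

text \<open>By Pascal's rule the increments of \<open>i choose m\<close> are
  \<open>i choose (m - 1)\<close>.\<close>

lemma weighted_sum_difference:
  "weighted_sum m x n = (\<Sum>i<n. real (i choose (m - 1)) * b i) - real (n choose m) * b n"
proof -
  obtain m' where m': "m = Suc m'" using m by (cases m) auto
  have "weighted_sum m x n = (\<Sum>i<n. b i * (real (Suc i choose m) - real (i choose m))) - real (n choose m) * b n"
    unfolding weighted_sum_def using m' by (intro sum_by_parts x) auto
  then show ?thesis by (simp add: m' mult.commute)
qed

text \<open>The squared sum on the left makes the identity telescope in \<open>n\<close>; dropping it gives a
  Hardy-type inequality.\<close>
lemma sum_dirichlet_term_difference:
  assumes "n \<ge> m"
  shows "m * (\<Sum>k<n. dirichlet_term m x k) + (\<Sum>i<n. real (i choose (m - 1)) * b i)\<^sup>2 / real (n choose m)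
    = (\<Sum>k<n. real (k choose (m - 1)) * (b k)\<^sup>2)"
  using assms
proof (induction n rule: dec_induct)
  case base
  obtain m' where m': "m = Suc m'" using m by (cases m) auto
  have "(\<Sum>i<m. real (i choose (m - 1)) * h i) = h m'" for h :: "nat \<Rightarrow> real"
  proof -
    have "(\<Sum>i<m'. real (i choose m') * h i) = 0"
      by (intro sum.neutral) auto
    then show ?thesis by (simp add: m')
  qed
  then show ?case by (simp add: m' dirichlet_term_eq_0)
next
  case (step n)
  define A C q where "A = (\<Sum>i<n. real (i choose (m - 1)) * b i)"
    and "C = real (n choose m)" and "q = real (n choose (m - 1))"
  have pos: "C > 0" "q > 0" using step by (auto simp: C_def q_def)
  \<comment> \<open>Absorption yields \<open>(n + 1) * q = m * (C + q)\<close>. This expresses the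
    weight in \<open>dirichlet_term\<close> through \<open>C\<close> and \<open>C + q\<close>, the
    values of the binomial at \<open>n\<close> and at \<open>Suc n\<close>.\<close>
  have "m * (n choose m) = (n + 1 - m) * (n choose (m - 1))"
  proof -
    obtain m' where m': "m = Suc m'" using m by (cases m) auto
    have "Suc m' * (n choose Suc m') = (n - m') * (n choose m')"
      by (simp only: binomial_absorb_comp binomial_absorption)
    then show ?thesis by (simp add: m')
  qed
  then have mC: "m * C = (n + 1 - m) * q"
    unfolding C_def q_def of_nat_mult[symmetric] by simp
  then have "(n + 1) * q = m * (C + q)"
    using step by (simp add: of_nat_diff algebra_simps)
  then have "m * (C * (C + q)) = q * (real (n + 1) * C)"
    by (metis mult.assoc mult.commute)
  then have coeff: "m / (real (n + 1) * C) = q / (C * (C + q))"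
    using pos by (subst frac_eq_eq) auto
  have C': "real (Suc n choose m) = C + q"
    using m by (cases m) (auto simp: C_def q_def)
  have "m * dirichlet_term m x n = m / (real (n + 1) * C) * (A - C * b n)\<^sup>2"
    by (simp add: dirichlet_term_def weighted_sum_difference A_def C_def)
  also have "\<dots> = q / (C * (C + q)) * (A - C * b n)\<^sup>2"
    unfolding coeff ..
  \<comment> \<open>The mixed terms in \<open>A * b n\<close> cancel, so the squared sum at
    \<open>Suc n\<close> is exchanged for the one at \<open>n\<close> plus the new summand on the
    right.\<close>
  also have "\<dots> + (A + q * b n)\<^sup>2 / (C + q) = A\<^sup>2 / C + q * (b n)\<^sup>2"
    using pos by (simp add: divide_simps) (simp add: power2_eq_square algebra_simps)
  finally show ?case
    using step.IH unfolding sum.lessThan_Suc C' A_def[symmetric] C_def[symmetric] q_def[symmetric]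
    by (simp add: distrib_left)
qed

lemma summable_dirichlet_term_difference:
  assumes "summable (\<lambda>k. real (k choose (m - 1)) * (b k)\<^sup>2)"
  shows "summable (dirichlet_term m x)"
proof (rule summableI_nonneg_bounded[OF dirichlet_term_nonneg])
  fix n
  let ?s = "\<Sum>k. real (k choose (m - 1)) * (b k)\<^sup>2"
  have "(\<Sum>k<n. dirichlet_term m x k) \<le> (\<Sum>k<max m n. dirichlet_term m x k)"
    by (intro sum_mono2) (auto simp: dirichlet_term_nonneg)
  also have "\<dots> \<le> m * (\<Sum>k<max m n. dirichlet_term m x k)"
    using m mult_right_mono[of 1 "real m" "\<Sum>k<max m n. dirichlet_term m x k"]
    by (simp add: sum_nonneg dirichlet_term_nonneg)
  also have "\<dots> \<le> (\<Sum>k<max m n. real (k choose (m - 1)) * (b k)\<^sup>2)"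
    by (subst sum_dirichlet_term_difference[symmetric]) auto
  also have "\<dots> \<le> ?s"
    by (intro sum_le_suminf assms) auto
  finally show "(\<Sum>k<n. dirichlet_term m x k) \<le> ?s" .
qed

end

subsection \<open>Cesaro numbers of order 1/2\<close>

text \<open>This is the Cesaro number of order -1/2, that is
  \<open>(2 * j choose j) / 4 ^ j\<close>, and the increment \<open>d\<close> of the numbers of
  order 1/2.\<close>

definition half_coeff :: "nat \<Rightarrow> real" where
  "half_coeff j = cesaro_coeff (1/2) j / (2 * j + 1)"

lemma cesaro_coeff_half_0: "cesaro_coeff (1/2) 0 = 1"
proof -
  have "Gamma (3/2 :: real) > 0" by (rule Gamma_real_pos) simp
  then show ?thesis by (simp add: cesaro_coeff_def less_imp_neq[THEN not_sym])
qed

lemma cesaro_coeff_half_Suc: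
  "cesaro_coeff (1/2) (Suc j) = cesaro_coeff (1/2) j * ((2 * j + 3) / (2 * j + 2))"
proof -
  have "real j + 3/2 \<notin> \<int>\<^sub>\<le>\<^sub>0" "real j + 1 \<notin> \<int>\<^sub>\<le>\<^sub>0"
    by (auto elim!: nonpos_Ints_cases)
  from this[THEN Gamma_plus1]
  have num: "Gamma (real (Suc j) + 1/2 + 1) = (real j + 3/2) * Gamma (real j + 1/2 + 1)"
    and den: "Gamma (real (Suc j) + 1) = (real j + 1) * Gamma (real j + 1)"
    by (simp_all add: add_ac)
  have ratio: "r * g / (G * (s * h)) = g / (G * h) * (2 * r / (2 * s))" for r s g h G :: real
    by (simp add: mult_ac)
  show ?thesis
    unfolding cesaro_coeff_def num den ratio by (simp add: algebra_simps)
qed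

lemma cesaro_coeff_half_pos: "cesaro_coeff (1/2) j > 0"
  by (induction j) (simp_all add: cesaro_coeff_half_0 cesaro_coeff_half_Suc)

lemma half_coeff_pos: "half_coeff j > 0"
  by (simp add: half_coeff_def cesaro_coeff_half_pos)

lemma half_coeff_0: "half_coeff 0 = 1"
  by (simp add: half_coeff_def cesaro_coeff_half_0)

lemma cesaro_coeff_half_diff:
  "cesaro_coeff (1/2) (Suc j) - cesaro_coeff (1/2) j = half_coeff (Suc j)"
proof -
  have "(2 * real j + 3) / (2 * real j + 2) = 1 + 1 / (2 * real j + 2)"
    by (simp add: field_simps)
  then have "cesaro_coeff (1/2) (Suc j) - cesaro_coeff (1/2) j = cesaro_coeff (1/2) j / (2 * real j + 2)"
    by (simp add: cesaro_coeff_half_Suc algebra_simps)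
  also have "\<dots> = half_coeff (Suc j)"
    by (simp add: half_coeff_def cesaro_coeff_half_Suc add_ac)
  finally show ?thesis .
qed

lemma cesaro_coeff_half_mono: "i \<le> j \<Longrightarrow> cesaro_coeff (1/2) i \<le> cesaro_coeff (1/2) j"
  by (rule lift_Suc_mono_le[of "cesaro_coeff (1/2)"])
    (use cesaro_coeff_half_diff half_coeff_pos in \<open>simp add: diff_eq_eq less_imp_le\<close>)

text \<open>The Cesaro numbers of order 1/2 grow like a square root. Through the ratio of
  consecutive numbers, the inductions reduce to
  \<open>4 * (j + 1) * (j + 2) \<le> (2 * j + 3)\<^sup>2\<close> and
  \<open>(2 * j + 1) * (2 * j + 3) \<le> (2 * j + 2)\<^sup>2\<close>.\<close>

lemma cesaro_coeff_half_square_bounds: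
  "real j + 1 \<le> (cesaro_coeff (1/2) j)\<^sup>2" "(cesaro_coeff (1/2) j)\<^sup>2 \<le> 2 * real j + 1"
proof (induction j)
  case 0
  { case 1 show ?case by (simp add: cesaro_coeff_half_0) }
  { case 2 show ?case by (simp add: cesaro_coeff_half_0) }
next
  case (Suc j)
  have eq: "(cesaro_coeff (1/2) (Suc j))\<^sup>2 = (cesaro_coeff (1/2) j)\<^sup>2 * ((2 * j + 3) / (2 * j + 2))\<^sup>2"
    by (simp add: cesaro_coeff_half_Suc power_mult_distrib power_divide)
  { case 1
    have "real (Suc j) + 1 \<le> (real j + 1) * ((2 * j + 3) / (2 * j + 2))\<^sup>2"
      by (simp add: power2_eq_square divide_simps) (simp add: algebra_simps)
    also have "\<dots> \<le> (cesaro_coeff (1/2) j)\<^sup>2 * ((2 * j + 3) / (2 * j + 2))\<^sup>2"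
      by (intro mult_right_mono Suc) simp
    finally show ?case unfolding eq . }
  { case 2
    have "(cesaro_coeff (1/2) j)\<^sup>2 * ((2 * j + 3) / (2 * j + 2))\<^sup>2 \<le> (2 * real j + 1) * ((2 * j + 3) / (2 * j + 2))\<^sup>2"
      by (intro mult_right_mono Suc) simp
    also have "\<dots> \<le> 2 * real (Suc j) + 1"
      by (simp add: power2_eq_square divide_simps) (simp add: algebra_simps)
    finally show ?case unfolding eq . }
qed

section \<open>Divergence of the squared differences, and the Cesaro multipliers\<close>

definition half_energy :: "nat \<Rightarrow> real" where
  "half_energy n = (\<Sum>i<n. (half_coeff i)\<^sup>2)"

lemma half_energy_mono: "k \<le> n \<Longrightarrow> half_energy k \<le> half_energy n"
  unfolding half_energy_def by (intro sum_mono2) auto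

lemma half_coeff_square_ge: "(half_coeff i)\<^sup>2 \<ge> 1 / (4 * (real i + 1))"
proof -
  have "1 / (4 * (real i + 1)) \<le> (real i + 1) / (2 * real i + 1)\<^sup>2"
    by (simp add: power2_eq_square divide_simps) (simp add: algebra_simps)
  also have "\<dots> \<le> (half_coeff i)\<^sup>2"
    unfolding half_coeff_def power_divide of_nat_add of_nat_mult of_nat_numeral of_nat_1
    by (intro divide_right_mono cesaro_coeff_half_square_bounds) simp
  finally show ?thesis .
qed

text \<open>A bound would make the harmonic series converge. Requiring \<open>n \<ge> k\<close> lets
  a block be placed arbitrarily far out while its energy is prescribed.\<close>

lemma half_energy_unbounded: "\<exists>n\<ge>k. half_energy n \<ge> B"
proof (rule ccontr)
  assume *: "\<not> ?thesis"
  have "(\<Sum>i<n. (half_coeff i)\<^sup>2) \<le> B" for n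
    using * half_energy_mono[of n "max k n"] unfolding half_energy_def by (metis max.cobounded1 max.cobounded2 linear order_trans)
  then have "summable (\<lambda>i. (half_coeff i)\<^sup>2)"
    by (intro summableI_nonneg_bounded) auto
  then have "summable (\<lambda>i. 1 / (4 * (real i + 1)))"
    by (rule summable_comparison_test'[where N = 0]) (use half_coeff_square_ge in auto)
  then have "summable (\<lambda>i. 4 * (1 / (4 * (real i + 1))))"
    by (rule summable_mult)
  moreover have "4 * (1 / (4 * (real i + 1))) = 1 / real (Suc i)" for i
    by (simp add: field_simps)
  ultimately have "summable (\<lambda>i. 1 / real (Suc i))"
    by (simp only:)
  then show False
    using not_summable_harmonic[where 'a = real]
    unfolding summable_Suc_iff[of "\<lambda>i. 1 / real i"] inverse_eq_divide by contradiction
qed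

definition cesaro_ratio :: "nat \<Rightarrow> nat \<Rightarrow> real" where
  "cesaro_ratio n i = (if i \<le> n then cesaro_coeff (1/2) (n - i) / cesaro_coeff (1/2) n else 0)"

lemma cesaro_ratio_bounds: "0 \<le> cesaro_ratio n i" "cesaro_ratio n i \<le> 1"
  using cesaro_coeff_half_pos[of n] cesaro_coeff_half_pos[of "n - i"] cesaro_coeff_half_mono[of "n - i" n]
  by (auto simp: cesaro_ratio_def)

text \<open>The final drop to 0 at \<open>i = n\<close> obeys the same formula because
  \<open>half_coeff 0 = cesaro_coeff (1/2) 0\<close>.\<close>

lemma cesaro_ratio_diff:
  "cesaro_ratio n i - cesaro_ratio n (Suc i) = (if i \<le> n then half_coeff (n - i) / cesaro_coeff (1/2) n else 0)"
proof (cases "i < n")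
  case True
  then have "n - i = Suc (n - Suc i)" by simp
  then show ?thesis
    using True cesaro_coeff_half_diff[of "n - Suc i"]
    by (simp add: cesaro_ratio_def flip: diff_divide_distrib)
qed (auto simp: cesaro_ratio_def half_coeff_def)

subsection \<open>The function supported on sparse blocks\<close>

text \<open>On the block this is the extremal direction of Cauchy-Schwarz for the pairing with
  \<open>half_coeff (2 * N - j)\<close>. The scaling fixes the pairing at
  \<open>1 / sqrt (real N ^ (m - 1))\<close> and leaves a weighted square norm of order
  \<open>1 / half_energy N\<close>.\<close>

definition block_fun :: "nat \<Rightarrow> nat \<Rightarrow> nat \<Rightarrow> real" where
  "block_fun m N j = half_coeff (2 * N - j) / (sqrt (real N ^ (m - 1)) * half_energy N)"

lemma block_fun_nonneg: "block_fun m N j \<ge> 0"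
  by (simp add: block_fun_def half_energy_def sum_nonneg less_imp_le[OF half_coeff_pos])

lemma sum_reflect_block:
  "(\<Sum>j\<in>{N<..2 * N}. h (2 * N - j)) = (\<Sum>i<N. h i)" for h :: "nat \<Rightarrow> real"
  by (rule sum.reindex_bij_witness[of _ "\<lambda>i. 2 * N - i" "\<lambda>j. 2 * N - j"]) auto

lemma half_energy_pos: "N \<ge> 1 \<Longrightarrow> half_energy N > 0"
  using half_energy_mono[of 1 N] by (simp add: half_energy_def half_coeff_0)

lemma sum_block_fun_half_coeff:
  assumes "N \<ge> 1"
  shows "(\<Sum>j\<in>{N<..2 * N}. block_fun m N j * half_coeff (2 * N - j)) = 1 / sqrt (real N ^ (m - 1))"
proof -
  have "(\<Sum>j\<in>{N<..2 * N}. block_fun m N j * half_coeff (2 * N - j))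
      = (\<Sum>j\<in>{N<..2 * N}. (half_coeff (2 * N - j))\<^sup>2) / (sqrt (real N ^ (m - 1)) * half_energy N)"
    by (simp add: block_fun_def power2_eq_square sum_divide_distrib)
  also have "\<dots> = half_energy N / (sqrt (real N ^ (m - 1)) * half_energy N)"
    by (subst sum_reflect_block) (simp add: half_energy_def)
  finally show ?thesis using half_energy_pos[OF assms] by simp
qed

text \<open>On the block the binomial is at most \<open>(2 * N) ^ (m - 1)\<close>, which the
  normalisation cancels up to \<open>2 ^ (m - 1)\<close>; summing the squares cancels one of the two
  factors \<open>half_energy N\<close>.\<close>

lemma sum_block_fun_square_le:
  assumes "N \<ge> 1"
  shows "(\<Sum>j\<in>{N<..2 * N}. real (j choose (m - 1)) * (block_fun m N j)\<^sup>2) \<le> 2 ^ (m - 1) / half_energy N"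
proof -
  have choose: "real (j choose (m - 1)) \<le> real (2 * N) ^ (m - 1)" if "j \<le> 2 * N" for j
  proof (cases "m - 1 \<le> j")
    case True
    then have "real (j choose (m - 1)) \<le> real j ^ (m - 1)"
      using binomial_le_pow[OF True] by (metis of_nat_le_iff of_nat_power)
    also have "\<dots> \<le> real (2 * N) ^ (m - 1)"
      using that by (intro power_mono) auto
    finally show ?thesis .
  next
    case False
    then have "j < m - 1" by simp
    then show ?thesis unfolding binomial_eq_0[OF \<open>j < m - 1\<close>] by simp
  qed
  have "(\<Sum>j\<in>{N<..2 * N}. real (j choose (m - 1)) * (block_fun m N j)\<^sup>2)
      \<le> (\<Sum>j\<in>{N<..2 * N}. real (2 * N) ^ (m - 1) * (block_fun m N j)\<^sup>2)"
    by (intro sum_mono mult_right_mono choose) auto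
  also have "\<dots> = (\<Sum>j\<in>{N<..2 * N}. 2 ^ (m - 1) / (half_energy N)\<^sup>2 * (half_coeff (2 * N - j))\<^sup>2)"
  proof (intro sum.cong refl)
    fix j
    have "real N ^ (m - 1) \<noteq> 0" using assms by simp
    moreover have "(block_fun m N j)\<^sup>2 = (half_coeff (2 * N - j))\<^sup>2 / (real N ^ (m - 1) * (half_energy N)\<^sup>2)"
      unfolding block_fun_def power_divide power_mult_distrib by (subst real_sqrt_pow2) auto
    ultimately show "real (2 * N) ^ (m - 1) * (block_fun m N j)\<^sup>2 = 2 ^ (m - 1) / (half_energy N)\<^sup>2 * (half_coeff (2 * N - j))\<^sup>2"
      using assms by (simp add: power_mult_distrib)
  qed
  also have "\<dots> = 2 ^ (m - 1) / (half_energy N)\<^sup>2 * (\<Sum>j\<in>{N<..2 * N}. (half_coeff (2 * N - j))\<^sup>2)"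
    by (rule sum_distrib_left[symmetric])
  also have "\<dots> = 2 ^ (m - 1) / half_energy N"
    by (subst sum_reflect_block) (simp add: half_energy_def power2_eq_square)
  finally show ?thesis .
qed

text \<open>The growth condition separates the blocks and leaves a gap up to \<open>4 * N l\<close>
  after each; the energy condition makes the block norms decay geometrically.\<close>

locale sparse_blocks =
  fixes m :: nat and N :: "nat \<Rightarrow> nat"
  assumes m: "m \<ge> 1"
    and N_ge: "N l \<ge> m"
    and N_growth: "4 * N l \<le> N (Suc l)"
    and N_energy: "half_energy (N l) \<ge> 2 ^ l"
begin

lemma N_ge_1: "N l \<ge> 1"
  using m N_ge[of l] by simp

lemma N_growth': "k < l \<Longrightarrow> 4 * N k \<le> N l"
proof (induction l)
  case (Suc l)
  then show ?case
    using N_growth[of l] by (cases "k = l") auto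
qed simp

lemma N_strict_mono: "strict_mono N"
proof (rule strict_monoI_Suc)
  show "N l < N (Suc l)" for l
    using N_growth[of l] N_ge_1[of l] by simp
qed

lemma block_unique: "j \<in> {N k<..2 * N k} \<Longrightarrow> j \<in> {N l<..2 * N l} \<Longrightarrow> k = l"
  using N_growth'[of k l] N_growth'[of l k] by (cases k l rule: linorder_cases) auto

text \<open>The sequence \<open>b\<close> of the construction. Blocks are disjoint by
  \<open>block_unique\<close>, so the description is well defined.\<close>

definition tail :: "nat \<Rightarrow> real" where
  "tail j = (if \<exists>l. j \<in> {N l<..2 * N l} then block_fun m (N (THE l. j \<in> {N l<..2 * N l})) j else 0)"

lemma tail_block: "j \<in> {N l<..2 * N l} \<Longrightarrow> tail j = block_fun m (N l) j"
proof -
  assume j: "j \<in> {N l<..2 * N l}"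
  then have "(THE l. j \<in> {N l<..2 * N l}) = l"
    using block_unique by (intro the_equality) auto
  then show ?thesis using j unfolding tail_def by auto
qed

lemma tail_eq_0: "(\<And>l. j \<notin> {N l<..2 * N l}) \<Longrightarrow> tail j = 0"
  unfolding tail_def by (rule if_not_P) blast

lemma tail_nonneg: "tail j \<ge> 0"
  by (simp add: tail_def block_fun_nonneg)

lemma tail_gap: "2 * N l < j \<Longrightarrow> j \<le> 4 * N l \<Longrightarrow> tail j = 0"
proof -
  assume j: "2 * N l < j" "j \<le> 4 * N l"
  have "j \<notin> {N k<..2 * N k}" for k
    using j N_growth'[of k l] N_growth'[of l k] by (cases k l rule: linorder_cases) auto
  then show ?thesis by (rule tail_eq_0)
qed

lemma summable_tail_square: "summable (\<lambda>k. real (k choose (m - 1)) * (tail k)\<^sup>2)"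
proof (rule summableI_nonneg_bounded)
  fix n
  let ?w = "\<lambda>k. real (k choose (m - 1)) * (tail k)\<^sup>2"
  let ?B = "\<lambda>l. {N l<..2 * N l}"
  have "(\<Sum>k<n. ?w k) = (\<Sum>k\<in>{..<n} \<inter> (\<Union>l<n. ?B l). ?w k)"
  proof (rule sum.mono_neutral_right)
    show "\<forall>k\<in>{..<n} - {..<n} \<inter> (\<Union>l<n. ?B l). ?w k = 0"
    proof
      fix k assume k: "k \<in> {..<n} - {..<n} \<inter> (\<Union>l<n. ?B l)"
      \<comment> \<open>Blocks with \<open>l < n\<close> are excluded by the choice of
        \<open>k\<close>; a later block starts beyond
        \<open>N l \<ge> l \<ge> n > k\<close>.\<close>
      have "k \<notin> ?B l" for l
        using k strict_mono_imp_increasing[OF N_strict_mono, of l] by (cases "l < n") auto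
      then have "tail k = 0" by (rule tail_eq_0)
      then show "?w k = 0" by simp
    qed
  qed auto
  also have "\<dots> \<le> (\<Sum>k\<in>(\<Union>l<n. ?B l). ?w k)"
    by (intro sum_mono2) auto
  also have "\<dots> = (\<Sum>l<n. \<Sum>k\<in>?B l. ?w k)"
  proof (rule sum.UNION_disjoint)
    show "\<forall>i\<in>{..<n}. \<forall>j\<in>{..<n}. i \<noteq> j \<longrightarrow> ?B i \<inter> ?B j = {}"
      using block_unique by blast
  qed auto
  also have "\<dots> \<le> (\<Sum>l<n. 2 ^ (m - 1) * (1 / 2) ^ l)"
  proof (rule sum_mono)
    fix l
    have "(\<Sum>k\<in>?B l. ?w k) = (\<Sum>k\<in>?B l. real (k choose (m - 1)) * (block_fun m (N l) k)\<^sup>2)"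
      by (intro sum.cong refl) (simp add: tail_block)
    also have "\<dots> \<le> 2 ^ (m - 1) / half_energy (N l)"
      by (rule sum_block_fun_square_le[OF N_ge_1])
    also have "\<dots> \<le> 2 ^ (m - 1) / 2 ^ l"
      using N_energy half_energy_pos[OF N_ge_1] by (intro divide_left_mono) auto
    finally show "(\<Sum>k\<in>?B l. ?w k) \<le> 2 ^ (m - 1) * (1 / 2) ^ l"
      by (simp add: power_one_over)
  qed
  also have "\<dots> \<le> 2 ^ (m - 1) * (\<Sum>l. (1 / 2) ^ l)"
    unfolding sum_distrib_left[symmetric]
    by (intro mult_left_mono sum_le_suminf summable_geometric) auto
  finally show "(\<Sum>k<n. ?w k) \<le> 2 ^ (m - 1) * (\<Sum>l. (1 / 2) ^ l)" .
qed auto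

text \<open>The weighted squares tend to 0 and their weights are at least 1 for
  \<open>k \<ge> m\<close>. The resulting bound on the coefficients gives convergence in the
  disc.\<close>

lemma eventually_tail_le_1: "eventually (\<lambda>k. tail k \<le> 1) sequentially"
proof -
  have "eventually (\<lambda>k. real (k choose (m - 1)) * (tail k)\<^sup>2 < 1) sequentially"
    using summable_LIMSEQ_zero[OF summable_tail_square] by (rule order_tendstoD) simp
  then show ?thesis
    using eventually_ge_at_top[of m]
  proof eventually_elim
    case (elim k)
    have "(tail k)\<^sup>2 = 1 * (tail k)\<^sup>2" by simp
    also have "\<dots> \<le> real (k choose (m - 1)) * (tail k)\<^sup>2"
      using elim by (intro mult_right_mono) (auto simp: Suc_le_eq)
    also have "\<dots> < 1" by (rule elim)
    finally show ?case
      using power2_le_imp_le[of "tail k" 1] by simp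
  qed
qed

text \<open>Natural subtraction makes \<open>a 0 = 0\<close>.\<close>

definition a :: "nat \<Rightarrow> real" where "a i = tail (i - 1) - tail i"

lemma summable_a: "norm z < 1 \<Longrightarrow> summable (\<lambda>k. of_real (a k) * z ^ k)" for z :: complex
proof (rule summable_comparison_test_ev)
  assume z: "norm z < 1"
  have "eventually (\<lambda>k. tail (k - 1) \<le> 1) sequentially"
    using eventually_tail_le_1
    by (rule eventually_sequentially_Suc[THEN iffD1, OF eventually_mono]) simp
  then show "eventually (\<lambda>k. norm (of_real (a k) * z ^ k) \<le> norm z ^ k) sequentially"
    using eventually_tail_le_1
  proof eventually_elim
    case (elim k)
    then have "\<bar>a k\<bar> \<le> 1"
      using tail_nonneg[of k] tail_nonneg[of "k - 1"] by (simp add: a_def)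
    then show ?case
      by (simp add: norm_mult norm_power mult_left_le_one_le)
  qed
  show "summable (\<lambda>k. norm z ^ k)" using z by (intro summable_geometric) simp
qed

section \<open>The error of the Cesaro means\<close>

definition err_coeff :: "nat \<Rightarrow> nat \<Rightarrow> real" where
  "err_coeff n i = (cesaro_ratio n i - 1) * a i"

lemma summable_dirichlet_term_a: "summable (dirichlet_term m a)"
  by (rule summable_dirichlet_term_difference[OF m _ summable_tail_square]) (simp add: a_def)

text \<open>The Cesaro mean is a polynomial, so from index \<open>n\<close> on the tails
  \<open>B\<close> of the error coincide with \<open>- tail\<close>, and finiteness carries
  over.\<close>

lemma summable_dirichlet_term_err: "summable (dirichlet_term m (err_coeff n))"
proof (rule summable_dirichlet_term_difference[OF m])
  define B where "B i = (\<Sum>j\<in>{i<..n}. cesaro_ratio n j * a j) - tail i" for i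
  show "err_coeff n i = B (i - 1) - B i" if "i \<ge> 1" for i
  proof (cases "i \<le> n")
    case True
    then have "{i - 1<..n} = insert i {i<..n}" using that by auto
    then show ?thesis by (simp add: B_def err_coeff_def a_def algebra_simps)
  next
    case False
    then have "{i - 1<..n} = {}" "{i<..n} = {}" using that by auto
    with False show ?thesis by (simp add: B_def err_coeff_def a_def cesaro_ratio_def)
  qed
  show "summable (\<lambda>k. real (k choose (m - 1)) * (B k)\<^sup>2)"
  proof (rule summable_cong[THEN iffD2, OF _ summable_tail_square])
    show "eventually (\<lambda>k. real (k choose (m - 1)) * (B k)\<^sup>2 = real (k choose (m - 1)) * (tail k)\<^sup>2) sequentially"
      using eventually_ge_at_top[of n] by eventually_elim (simp add: B_def)
  qed
qed

text \<open>Summation by parts leaves only terms of one sign, because \<open>tail\<close> is nonnegative and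
  \<open>(i choose m) * (1 - cesaro_ratio n i)\<close> increases with \<open>i\<close>.\<close>
lemma weighted_sum_err_le:
  assumes K: "2 * N l < K" "K \<le> 4 * N l"
  shows "real (N l choose m) / (cesaro_coeff (1/2) (2 * N l) * sqrt (real (N l) ^ (m - 1)))
    \<le> - weighted_sum m (err_coeff (2 * N l)) K"
proof -
  define n c v where "n = 2 * N l" and "c = cesaro_coeff (1/2) n" and "v i = real (i choose m) * (1 - cesaro_ratio n i)" for i
  have c: "c > 0" by (simp add: c_def cesaro_coeff_half_pos)
  \<comment> \<open>Only the drop of the Cesaro multiplier is kept; the growth of the binomial
    contributes a nonnegative amount.\<close>
  have inc: "real (i choose m) * (cesaro_ratio n i - cesaro_ratio n (Suc i)) \<le> v (Suc i) - v i" for i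
  proof -
    have "real (i choose m) * (1 - cesaro_ratio n (Suc i)) \<le> real (Suc i choose m) * (1 - cesaro_ratio n (Suc i))"
      using cesaro_ratio_bounds[of n "Suc i"] by (intro mult_right_mono) (auto intro: binomial_right_mono)
    then show ?thesis by (simp add: v_def algebra_simps)
  qed
  have pos: "0 \<le> v (Suc i) - v i" for i
  proof -
    have "0 \<le> real (i choose m) * (cesaro_ratio n i - cesaro_ratio n (Suc i))"
      unfolding cesaro_ratio_diff using cesaro_coeff_half_pos[of n] half_coeff_pos[of "n - i"] by simp
    then show ?thesis using inc[of i] by linarith
  qed
  have "real (N l choose m) / (c * sqrt (real (N l) ^ (m - 1)))
      = (\<Sum>j\<in>{N l<..2 * N l}. block_fun m (N l) j * half_coeff (2 * N l - j)) * (real (N l choose m) / c)"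
    by (simp add: sum_block_fun_half_coeff[OF N_ge_1])
  also have "\<dots> = (\<Sum>j\<in>{N l<..2 * N l}. tail j * (real (N l choose m) * (half_coeff (n - j) / c)))"
    unfolding sum_distrib_right by (intro sum.cong refl) (simp add: tail_block n_def)
  also have "\<dots> \<le> (\<Sum>j\<in>{N l<..2 * N l}. tail j * (v (Suc j) - v j))"
  proof (intro sum_mono mult_left_mono tail_nonneg)
    fix j assume j: "j \<in> {N l<..2 * N l}"
    have "real (N l choose m) * (half_coeff (n - j) / c) \<le> real (j choose m) * (half_coeff (n - j) / c)"
      using j c half_coeff_pos[of "n - j"] by (intro mult_right_mono) (auto intro: binomial_right_mono)
    also have "\<dots> = real (j choose m) * (cesaro_ratio n j - cesaro_ratio n (Suc j))"
      using j by (simp add: cesaro_ratio_diff n_def c_def)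
    also have "\<dots> \<le> v (Suc j) - v j" by (rule inc)
    finally show "real (N l choose m) * (half_coeff (n - j) / c) \<le> v (Suc j) - v j" .
  qed
  also have "\<dots> \<le> (\<Sum>j<K. tail j * (v (Suc j) - v j))"
    using K by (intro sum_mono2) (auto intro: mult_nonneg_nonneg tail_nonneg pos)
  \<comment> \<open>Since \<open>K\<close> lies in the gap, \<open>tail K = 0\<close> and the
    boundary term of summation by parts vanishes.\<close>
  also have "\<dots> = (\<Sum>i\<le>K. v i * a i)"
    using tail_gap[OF K] m by (subst sum_by_parts[where b = tail]) (auto simp: v_def a_def)
  also have "\<dots> = - weighted_sum m (err_coeff n) K"
    by (simp add: weighted_sum_def v_def err_coeff_def sum_negf[symmetric] algebra_simps)
  finally show ?thesis by (simp add: n_def c_def)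
qed

text \<open>With \<open>M = N l\<close>, the squared weighted sum is at least
  \<open>M ^ m / (5 * m ^ (2 * m))\<close>, because the square of the Cesaro number is at most
  \<open>5 * M\<close>. The denominator of the term is at most \<open>5 * M * (4 * M) ^ m\<close>,
  so the quotient is of order \<open>1 / M\<close>.\<close>

lemma dirichlet_term_err_ge:
  assumes K: "2 * N l < K" "K \<le> 4 * N l"
  shows "1 / (25 * 4 ^ m * real m ^ (2 * m)) / real (N l) \<le> dirichlet_term m (err_coeff (2 * N l)) K"
proof -
  define M c where "M = real (N l)" and "c = cesaro_coeff (1/2) (2 * N l)"
  have M: "M \<ge> 1" using N_ge_1[of l] by (simp add: M_def)
  have c: "c > 0" "c\<^sup>2 \<le> 5 * M"
    using cesaro_coeff_half_square_bounds(2)[of "2 * N l"] M by (auto simp: c_def M_def cesaro_coeff_half_pos)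
  have Km: "m \<le> K" using K N_ge[of l] by simp
  have "real (K choose m) \<le> real K ^ m"
    using binomial_le_pow[OF Km] by (metis of_nat_le_iff of_nat_power)
  also have "\<dots> \<le> (4 * M) ^ m"
    using K by (intro power_mono) (auto simp: M_def)
  finally have den1: "real (K choose m) \<le> (4 * M) ^ m" .
  have den2: "real (K + 1) \<le> 5 * M" 
  proof -
    have "K + 1 \<le> 5 * N l" using K N_ge_1[of l] by simp
    then have "real (K + 1) \<le> real (5 * N l)" by (simp only: of_nat_le_iff)
    then show ?thesis by (simp add: M_def)
  qed
  have "(M / m) ^ m \<le> real (N l choose m)"
    using binomial_ge_n_over_k_pow_k[OF N_ge[of l], where 'a = real] by (simp add: M_def)
  moreover have "real (N l choose m) / (c * sqrt (M ^ (m - 1))) \<le> \<bar>weighted_sum m (err_coeff (2 * N l)) K\<bar>"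
    using weighted_sum_err_le[OF K] by (simp add: c_def M_def)
  ultimately have "(M / m) ^ m / (c * sqrt (M ^ (m - 1))) \<le> \<bar>weighted_sum m (err_coeff (2 * N l)) K\<bar>"
    using c M by (elim order_trans[rotated]) (intro divide_right_mono, auto)
  then have "((M / m) ^ m / (c * sqrt (M ^ (m - 1))))\<^sup>2 \<le> \<bar>weighted_sum m (err_coeff (2 * N l)) K\<bar>\<^sup>2"
    using c M by (intro power_mono) auto
  then have "(M / m) ^ (2 * m) / (c\<^sup>2 * M ^ (m - 1)) \<le> (weighted_sum m (err_coeff (2 * N l)) K)\<^sup>2"
    using M by (simp add: power_divide power_mult_distrib power_even_eq)
  moreover have "(M / m) ^ (2 * m) / (5 * M * M ^ (m - 1)) \<le> (M / m) ^ (2 * m) / (c\<^sup>2 * M ^ (m - 1))"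
    using c M by (intro divide_left_mono mult_right_mono) auto
  ultimately have num: "(M / m) ^ (2 * m) / (5 * M ^ m) \<le> (weighted_sum m (err_coeff (2 * N l)) K)\<^sup>2"
    using m by (simp flip: power_Suc add: mult.assoc)
  have "1 / (25 * 4 ^ m * real m ^ (2 * m)) / M = ((M / m) ^ (2 * m) / (5 * M ^ m)) / ((5 * M) * (4 * M) ^ m)"
    using M by (simp add: power_divide power_mult_distrib power_mult power2_eq_square field_simps)
  also have "\<dots> \<le> (weighted_sum m (err_coeff (2 * N l)) K)\<^sup>2 / (real (K + 1) * real (K choose m))"
    using M Km num den1 den2 by (intro frac_le mult_mono mult_pos_pos) auto
  finally show ?thesis by (simp add: dirichlet_term_def M_def)
qed

text \<open>The gap holds \<open>2 * N l\<close> indices, each contributing a fixed multiple of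
  \<open>1 / N l\<close>; the total does not depend on \<open>l\<close>.\<close>

lemma suminf_dirichlet_term_err_ge:
  "2 / (25 * 4 ^ m * real m ^ (2 * m)) \<le> suminf (dirichlet_term m (err_coeff (2 * N l)))"
proof -
  have "2 / (25 * 4 ^ m * real m ^ (2 * m)) = (\<Sum>K\<in>{2 * N l<..4 * N l}. 1 / (25 * 4 ^ m * real m ^ (2 * m)) / real (N l))"
    using N_ge_1[of l] by simp
  also have "\<dots> \<le> (\<Sum>K\<in>{2 * N l<..4 * N l}. dirichlet_term m (err_coeff (2 * N l)) K)"
    by (intro sum_mono dirichlet_term_err_ge) auto
  also have "\<dots> \<le> suminf (dirichlet_term m (err_coeff (2 * N l)))"
    by (intro sum_le_suminf summable_dirichlet_term_err) (auto simp: dirichlet_term_nonneg)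
  finally show ?thesis .
qed

end

section \<open>Choice of the blocks and the counterexample\<close>

lemma sparse_blocks_exist: "m \<ge> 1 \<Longrightarrow> \<exists>N. sparse_blocks m N"
proof -
  assume m: "m \<ge> 1"
  have "\<exists>N. \<forall>l. (N l \<ge> m \<and> half_energy (N l) \<ge> 2 ^ l) \<and> 4 * N l \<le> N (Suc l)"
  proof (rule dependent_nat_choice)
    show "\<exists>n. n \<ge> m \<and> half_energy n \<ge> 2 ^ 0"
      using half_energy_unbounded[of m "2 ^ 0"] by blast
    show "\<exists>k. (k \<ge> m \<and> half_energy k \<ge> 2 ^ Suc l) \<and> 4 * n \<le> k" for n l
      using half_energy_unbounded[of "max m (4 * n)" "2 ^ Suc l"] by auto
  qed
  then show ?thesis using m by (auto simp: sparse_blocks_def)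
qed

theorem theorem1p3:
  fixes m :: nat and \<zeta> :: complex
  assumes "m \<ge> 1" and "\<zeta> \<in> sphere 0 1"
  shows "\<exists>f \<in> local_dirichlet_space \<zeta> m.
           \<not> (\<lambda>n. dirichlet_integral \<zeta> m (\<lambda>z. cesaro_mean (1/2) n f z - f z)) \<longlonglongrightarrow> 0"
proof -
  obtain N where "sparse_blocks m N"
    using sparse_blocks_exist[OF assms(1)] by blast
  then interpret sparse_blocks m N .
  have \<zeta>: "norm \<zeta> = 1" using assms(2) by simp
  \<comment> \<open>The powers of \<open>cnj \<zeta>\<close> rotate the singular point
    \<open>\<zeta>\<close> to 1, leaving real coefficients.\<close>
  define F where "F = Abs_fps (\<lambda>k. of_real (a k) * cnj \<zeta> ^ k)"
  define f where "f = eval_fps F"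
  have F_summable: "summable (\<lambda>k. fps_nth F k * z ^ k)" if "norm z < 1" for z
    using summable_a[of "cnj \<zeta> * z"] that \<zeta> by (simp add: F_def norm_mult power_mult_distrib mult.assoc)
  then have F: "fps_conv_radius F \<ge> 1" by (rule fps_conv_radius_ge_1I)
  have f_sums: "(\<lambda>k. of_real (a k) * cnj \<zeta> ^ k * z ^ k) sums f z" if "norm z < 1" for z
    using summable_sums[OF F_summable[OF that]] by (simp add: f_def eval_fps_def F_def)
  have "dirichlet_integral \<zeta> m f \<le> ennreal (m * suminf (dirichlet_term m a))"
    by (rule dirichlet_integral_power_series(1)[OF m \<zeta> f_sums summable_dirichlet_term_a])
  then have "dirichlet_integral \<zeta> m f < \<infinity>"
    by (rule le_less_trans) simp
  moreover have "f holomorphic_on ball 0 1"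
    unfolding f_def using F by (intro holomorphic_on_eval_fps) (auto intro: norm_less_fps_conv_radius)
  ultimately have f: "f \<in> local_dirichlet_space \<zeta> m"
    by (simp add: local_dirichlet_space_def)
  have "fps_expansion f 0 = F"
    unfolding f_def using F
    by (intro fps_expansion_eqI eval_fps_has_fps_expansion) (auto intro: less_le_trans[of _ 1])
  then have nth: "fps_nth (fps_expansion f 0) k = of_real (a k) * cnj \<zeta> ^ k" for k
    by (simp add: F_def)
  have err_sums: "(\<lambda>k. of_real (err_coeff n k) * cnj \<zeta> ^ k * z ^ k) sums (cesaro_mean (1/2) n f z - f z)"
    if "norm z < 1" for z n
  proof -
    \<comment> \<open>The Cesaro mean is read as a power series with finitely many nonzero terms, so
      that \<open>f\<close> can be subtracted termwise.\<close>
    have "(\<lambda>k. if k \<in> {0..n} then of_real (cesaro_ratio n k * a k) * cnj \<zeta> ^ k * z ^ k else 0) sums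
        (\<Sum>k\<in>{0..n}. of_real (cesaro_ratio n k * a k) * cnj \<zeta> ^ k * z ^ k)"
      by (rule sums_If_finite_set) simp
    also have "(\<Sum>k\<in>{0..n}. of_real (cesaro_ratio n k * a k) * cnj \<zeta> ^ k * z ^ k) = cesaro_mean (1/2) n f z"
      unfolding cesaro_mean_def nth sum_distrib_left
    proof (rule sum.cong)
      fix k assume "k \<in> {0..n}"
      then have ratio: "cesaro_ratio n k = inverse (cesaro_coeff (1/2) n) * cesaro_coeff (1/2) (n - k)"
        by (simp add: cesaro_ratio_def field_simps)
      show "of_real (cesaro_ratio n k * a k) * cnj \<zeta> ^ k * z ^ k = of_real (inverse (cesaro_coeff (1/2) n))
          * (of_real (cesaro_coeff (1/2) (n - k)) * (of_real (a k) * cnj \<zeta> ^ k) * z ^ k)"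
        unfolding ratio of_real_mult by (simp only: mult.assoc)
    qed simp
    finally have "(\<lambda>k. (if k \<in> {0..n} then of_real (cesaro_ratio n k * a k) * cnj \<zeta> ^ k * z ^ k else 0)
        - of_real (a k) * cnj \<zeta> ^ k * z ^ k) sums (cesaro_mean (1/2) n f z - f z)"
      by (intro sums_diff f_sums that)
    moreover have "(if k \<in> {0..n} then of_real (cesaro_ratio n k * a k) * cnj \<zeta> ^ k * z ^ k else 0)
        - of_real (a k) * cnj \<zeta> ^ k * z ^ k = of_real (err_coeff n k) * cnj \<zeta> ^ k * z ^ k" for k
      by (simp add: err_coeff_def cesaro_ratio_def algebra_simps)
    ultimately show ?thesis by simp
  qed
  define \<kappa> where "\<kappa> = m * (2 / (25 * 4 ^ m * real m ^ (2 * m)))"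
  have \<kappa>: "\<kappa> > 0" using m by (simp add: \<kappa>_def)
  let ?D = "\<lambda>n. dirichlet_integral \<zeta> m (\<lambda>z. cesaro_mean (1/2) n f z - f z)"
  \<comment> \<open>The lower bound is uniform along the subsequence \<open>n = 2 * N l\<close>,
    which already excludes convergence to 0.\<close>
  have lower: "ennreal \<kappa> \<le> 2 * ?D (2 * N l)" for l
  proof -
    have "\<kappa> \<le> m * suminf (dirichlet_term m (err_coeff (2 * N l)))"
      unfolding \<kappa>_def by (intro mult_left_mono suminf_dirichlet_term_err_ge) simp
    then have "ennreal \<kappa> \<le> ennreal (m * suminf (dirichlet_term m (err_coeff (2 * N l))))"
      by (rule ennreal_leI)
    also have "\<dots> \<le> 2 * ?D (2 * N l)"
      by (rule dirichlet_integral_power_series(2)[OF m \<zeta> err_sums summable_dirichlet_term_err])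
    finally show ?thesis .
  qed
  have "\<not> ?D \<longlonglongrightarrow> 0"
  proof
    assume "?D \<longlonglongrightarrow> 0"
    moreover have "strict_mono (\<lambda>l. 2 * N l)"
      using N_strict_mono by (simp add: strict_mono_def)
    ultimately have "(\<lambda>l. ?D (2 * N l)) \<longlonglongrightarrow> 0"
      using LIMSEQ_subseq_LIMSEQ unfolding comp_def by blast
    then have "(\<lambda>l. 2 * ?D (2 * N l)) \<longlonglongrightarrow> 2 * 0"
      by (intro ennreal_tendsto_cmult) auto
    then have "ennreal \<kappa> \<le> 2 * 0"
      by (rule LIMSEQ_le_const) (use lower in blast)
    then show False using \<kappa> by simp
  qed
  with f show ?thesis by blast
qed

end
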